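(* Let $\mathbb{A}$ be a finite dimensional nontrivial associative real $^*$-algebra with unit, with $\mathbb{S}_{\mathbb{A}}\ne\varnothing$ and with a complete submultiplicative norm $|\cdot|$ such that $|q|^2=qq^c$ for all $q\in Q_{\mathbb{A}}$, and let $X$ be a Banach two-sided $\mathbb{A}$-module. Let $\mathsf{T}:[0,\infty)\to\mathscr{L}^r(X)$ be a strongly continuous right linear semigroup, let $\mathsf{A}:D(\mathsf{A})\to X$ be its generator, and let $\omega\in\mathbb{R}$ be such that $M:=\sup_{t\in[0,\infty)}\|\mathsf{T}(t)\|e^{-\omega t}<\infty$. Then for every $q\in Q_{\mathbb{A}}$ with $\mathrm{Re}(q)>\omega$ we have $q\in\rho_S(\mathsf{A})$ and, for every integer $n\ge1$ and every $x\in X$, $$\mathsf{Q}_q(\mathsf{A})^nx=(-1)^n\int_0^\infty\mathsf{T}(t)\exp'_s(-t,q)^{\star n}x\,dt,$$ where $\exp'_s(-t,q)^{\star n}$ denotes the value at $t$ of the $n$-fold convolution power of the function $[0,\infty)\ni\tau\mapsto\exp'_s(-\tau,q)$. Moreover, for every $q\in Q_{\mathbb{A}}$ with $\mathrm{Re}(q)>\omega$, $$\|\mathsf{Q}_q(\mathsf{A})^n\|\le\frac{M}{(\mathrm{Re}(q)-\omega)^{2n}}\qquad\forall n\in\mathbb{N}\setminus\{0\}.$$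
   Context: A real $^*$-algebra $\mathbb{A}$ is a real algebra with unit $1$ together with an $\mathbb{R}$-linear map $q\mapsto q^c$ such that $(q^c)^c=q$, $(pq)^c=q^cp^c$ and $r^c=r$ for $r\in\mathbb{R}$, where $\mathbb{R}$ is identified with $\mathbb{R}1$. Put $\mathbb{S}_{\mathbb{A}}:=\{q\in\mathbb{A}: q^c=-q,\ q^2=-1\}$, $\mathbb{C}_{\mathbf{j}}:=\{r+s\mathbf{j}: r,s\in\mathbb{R}\}$ for $\mathbf{j}\in\mathbb{S}_{\mathbb{A}}$, and $Q_{\mathbb{A}}:=\bigcup_{\mathbf{j}\in\mathbb{S}_{\mathbb{A}}}\mathbb{C}_{\mathbf{j}}$ (quadratic cone); $qq^c\in\mathbb{R}$ for $q\in Q_{\mathbb{A}}$. Submultiplicative means $|q_1q_2|\le|q_1||q_2|$ for all $q_1,q_2\in\mathbb{A}$. $\mathrm{Re}(q):=(q+q^c)/2$, which is real for $q\in Q_{\mathbb{A}}$. For $t\in\mathbb{R}$ and $q\in Q_{\mathbb{A}}\setminus\mathbb{R}$, $\exp'_s(t,q):=(q-q^c)^{-1}(e^{tq}-e^{tq^c})$, where $e^{tq}:=\sum_{k\ge0}(tq)^k/k!$; for fixed $t$ this extends uniquely to a continuous function of $q\in Q_{\mathbb{A}}$, still denoted $\exp'_s(t,\cdot)$, with $\exp'_s(t,q)=te^{tq}$ for $q\in\mathbb{R}$. For continuous $f,g:[0,\infty)\to\mathbb{A}$, $(f\star g)(t):=\int_0^tf(t-s)g(s)\,ds$, and $f^{\star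 n}:=f\star\cdots\star f$ ($n$ factors). A two-sided $\mathbb{A}$-module $X$ is a commutative group $(X,+)$ with left and right scalar multiplications by $\mathbb{A}$, each distributive in both arguments, with $1x=x=x1$, $p(qx)=(pq)x$, $(xp)q=x(pq)$, $p(xq)=(px)q$ for $p,q\in\mathbb{A}$, and $rx=xr$ for $r\in\mathbb{R}$. It is a Banach two-sided $\mathbb{A}$-module if it has a function $\|\cdot\|:X\to[0,\infty)$ with $\|x\|=0\iff x=0$, $\|x+y\|\le\|x\|+\|y\|$, $\|qx\|\le|q|\|x\|$, $\|xq\|\le|q|\|x\|$, and the metric $\|x-y\|$ is complete. In particular $X$ is a real Banach space, and $X$-valued integrals are Lebesgue (Bochner) integrals in it. A right linear operator is an additive map $\mathsf{A}:D(\mathsf{A})\to X$, where $D(\mathsf{A})\subseteq X$ is a right $\mathbb{A}$-submodule (an additive subgroup closed under right multiplication by $\mathbb{A}$), with $\mathsf{A}(xq)=\mathsf{A}(x)q$. $\mathscr{L}^r(X)$ is the set of right linear $\mathsf{B}:X\to X$ with $\|\mathsf{B}\|:=\sup_{x\ne0}\|\mathsf{B}x\|/\|x\|<\infty$. $D(\mathsf{A}^2)=\{x\in D(\mathsf{A}):\mathsf{A}x\in D(\mathsf{A})\}$. A strongly continuous right linear semigroup is a map $\mathsf{T}:[0,\infty)\to\mathscr{L}^r(X)$ such that $t\mapsto\mathsf{T}(t)x$ is continuous for every $x\in X$, $\mathsf{T}(t+s)=\mathsf{T}(t)\mathsf{T}(s)$ for $t,s>0$, and $\mathsf{T}(0)=\mathrm{Id}$.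 Its generator is $\mathsf{A}x:=\lim_{h\to0^+}\frac1h(\mathsf{T}(h)x-x)$, with $D(\mathsf{A})$ the set of $x\in X$ for which this limit exists in $X$. For $q\in Q_{\mathbb{A}}$, $\Delta_q(\mathsf{A}):=\mathsf{A}^2-2\mathrm{Re}(q)\mathsf{A}+|q|^2\mathrm{Id}:D(\mathsf{A}^2)\to X$. The spherical resolvent set $\rho_S(\mathsf{A})$ is the set of $q\in Q_{\mathbb{A}}$ such that $\Delta_q(\mathsf{A})$ is bijective with $\Delta_q(\mathsf{A})^{-1}\in\mathscr{L}^r(X)$; for such $q$, $\mathsf{Q}_q(\mathsf{A}):=\Delta_q(\mathsf{A})^{-1}$ (spherical quasi-resolvent operator). *)

theory Defs
  imports "HOL-Analysis.Analysis"
begin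

text \<open>
  The class \<open>real_normed_algebra_1\<close> contains the axiom \<open>norm 1 = 1\<close>. For the algebras considered
  here this is no restriction: it follows from \<open>|q|\<^sup>2 = q q\<^sup>c\<close> at \<open>q = 1\<close>, which lies in the
  quadratic cone as soon as there is an imaginary unit.
\<close>

locale star_algebra =
  fixes cj :: "'a::real_algebra_1 \<Rightarrow> 'a"
  assumes cj_linear: "linear cj"
    and cj_cj: "cj (cj q) = q"
    and cj_mult: "cj (p * q) = cj q * cj p"
    and cj_of_real: "cj (of_real r) = of_real r"

definition imag_units :: "('a::real_algebra_1 \<Rightarrow> 'a) \<Rightarrow> 'a set" where
  "imag_units cj = {q. cj q = - q \<and> q\<^sup>2 = - 1}"

definition complex_slice :: "'a::real_algebra_1 \<Rightarrow> 'a set" where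
  "complex_slice j = {of_real r + s *\<^sub>R j | r s. True}"

definition quadratic_cone :: "('a::real_algebra_1 \<Rightarrow> 'a) \<Rightarrow> 'a set" where
  "quadratic_cone cj = (\<Union>j\<in>imag_units cj. complex_slice j)"

text \<open>On the quadratic cone \<open>(q + q\<^sup>c)/2\<close> is a real multiple of 1; \<open>re_part\<close> is that real number.\<close>

definition re_part :: "('a::real_algebra_1 \<Rightarrow> 'a) \<Rightarrow> 'a \<Rightarrow> real" where
  "re_part cj q = (THE r. of_real r = (1/2) *\<^sub>R (q + cj q))"

definition alg_inverse :: "'a::ring_1 \<Rightarrow> 'a" where
  "alg_inverse p = (THE y. p * y = 1 \<and> y * p = 1)"

text \<open>The first branch is the value at real \<open>q\<close> of the continuous extension to the quadratic cone.\<close>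

definition exp_s' :: "('a::{real_normed_algebra_1,banach} \<Rightarrow> 'a) \<Rightarrow> real \<Rightarrow> 'a \<Rightarrow> 'a" where
  "exp_s' cj t q =
     (if q \<in> \<real> then t *\<^sub>R exp (t *\<^sub>R q)
      else alg_inverse (q - cj q) * (exp (t *\<^sub>R q) - exp (t *\<^sub>R cj q)))"

text \<open>
  Convolution is only applied to functions continuous on \<open>[0,\<infinity>)\<close>, so the integral is an ordinary
  integral of a continuous function over a compact interval.
\<close>

definition conv :: "(real \<Rightarrow> 'a::{real_normed_algebra_1,banach}) \<Rightarrow> (real \<Rightarrow> 'a) \<Rightarrow> real \<Rightarrow> 'a" where
  "conv f g t = integral {0..t} (\<lambda>s. f (t - s) * g s)"

text \<open>The convolution power with \<open>n\<close> factors, for \<open>n \<ge> 1\<close> only (no unit for convolution exists).\<close>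

definition conv_power :: "(real \<Rightarrow> 'a::{real_normed_algebra_1,banach}) \<Rightarrow> nat \<Rightarrow> real \<Rightarrow> 'a" where
  "conv_power f n = (conv f ^^ (n - 1)) f"

text \<open>
  The library's \<open>has_bochner_integral\<close> restricts the target to second countable spaces. The following
  is the same definition for arbitrary normed spaces; the lemma below records the agreement.
\<close>

inductive has_bochner :: "'b measure \<Rightarrow> ('b \<Rightarrow> 'x) \<Rightarrow> 'x::real_normed_vector \<Rightarrow> bool"
  for M f I where
  "f \<in> borel_measurable M \<Longrightarrow>
    (\<And>i. Bochner_Integration.simple_bochner_integrable M (s i)) \<Longrightarrow>
    (\<lambda>i. \<integral>\<^sup>+x. norm (f x - s i x) \<partial>M) \<longlonglongrightarrow> 0 \<Longrightarrow>
    (\<lambda>i. Bochner_Integration.simple_bochner_integral M (s i)) \<longlonglongrightarrow> I \<Longrightarrow>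
    has_bochner M f I"

lemma has_bochner_iff_has_bochner_integral:
  fixes f :: "'b \<Rightarrow> 'x::{real_normed_vector, second_countable_topology}"
  shows "has_bochner M f I \<longleftrightarrow> has_bochner_integral M f I"
  by (simp add: has_bochner.simps has_bochner_integral.simps)

definition bochner_integrable :: "'b measure \<Rightarrow> ('b \<Rightarrow> 'x::real_normed_vector) \<Rightarrow> bool" where
  "bochner_integrable M f \<longleftrightarrow> (\<exists>I. has_bochner M f I)"

definition bochner_integral :: "'b measure \<Rightarrow> ('b \<Rightarrow> 'x::real_normed_vector) \<Rightarrow> 'x" where
  "bochner_integral M f = (THE I. has_bochner M f I)"

text \<open>
  \<open>lm q x\<close> is \<open>q x\<close> and \<open>rm x q\<close> is \<open>x q\<close>. The real vector space structure of the type \<open>'x\<close> is the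
  one induced by the scalar multiplications (\<open>lm_of_real\<close>, \<open>rm_of_real\<close>).
\<close>

locale banach_two_sided_module =
  fixes lm :: "'a::real_normed_algebra_1 \<Rightarrow> 'x::banach \<Rightarrow> 'x"
    and rm :: "'x \<Rightarrow> 'a \<Rightarrow> 'x"
  assumes lm_add_right: "lm q (x + y) = lm q x + lm q y"
    and lm_add_left: "lm (p + q) x = lm p x + lm q x"
    and rm_add_left: "rm (x + y) q = rm x q + rm y q"
    and rm_add_right: "rm x (p + q) = rm x p + rm x q"
    and lm_one: "lm 1 x = x"
    and rm_one: "rm x 1 = x"
    and lm_assoc: "lm p (lm q x) = lm (p * q) x"
    and rm_assoc: "rm (rm x p) q = rm x (p * q)"
    and lm_rm: "lm p (rm x q) = rm (lm p x) q"
    and lm_of_real: "lm (of_real r) x = r *\<^sub>R x"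
    and rm_of_real: "rm x (of_real r) = r *\<^sub>R x"
    and norm_lm: "norm (lm q x) \<le> norm q * norm x"
    and norm_rm: "norm (rm x q) \<le> norm q * norm x"

definition right_submodule :: "('x::ab_group_add \<Rightarrow> 'a \<Rightarrow> 'x) \<Rightarrow> 'x set \<Rightarrow> bool" where
  "right_submodule rm D \<longleftrightarrow>
     0 \<in> D \<and> (\<forall>x\<in>D. \<forall>y\<in>D. x + y \<in> D) \<and> (\<forall>x\<in>D. - x \<in> D) \<and> (\<forall>x\<in>D. \<forall>q. rm x q \<in> D)"

text \<open>An operator with domain \<open>D\<close> is a total function of which only the values on \<open>D\<close> matter.\<close>

definition right_linear_on ::
    "('x::ab_group_add \<Rightarrow> 'a \<Rightarrow> 'x) \<Rightarrow> 'x set \<Rightarrow> ('x \<Rightarrow> 'x) \<Rightarrow> bool" where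
  "right_linear_on rm D A \<longleftrightarrow>
     right_submodule rm D \<and> (\<forall>x\<in>D. \<forall>y\<in>D. A (x + y) = A x + A y)
     \<and> (\<forall>x\<in>D. \<forall>q. A (rm x q) = rm (A x) q)"

text \<open>
  The operator norm is the library's \<open>onorm B = (SUP x. norm (B x) / norm x)\<close>, in which \<open>x = 0\<close>
  contributes \<open>0\<close>.
\<close>

definition bounded_right_linear ::
    "('x::real_normed_vector \<Rightarrow> 'a \<Rightarrow> 'x) \<Rightarrow> ('x \<Rightarrow> 'x) set" where
  "bounded_right_linear rm =
     {B. right_linear_on rm UNIV B \<and> bdd_above (range (\<lambda>x. norm (B x) / norm x))}"

definition strongly_continuous_semigroup ::
    "('x::real_normed_vector \<Rightarrow> 'a \<Rightarrow> 'x) \<Rightarrow> (real \<Rightarrow> 'x \<Rightarrow> 'x) \<Rightarrow> bool" where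
  "strongly_continuous_semigroup rm T \<longleftrightarrow>
     (\<forall>t\<ge>0. T t \<in> bounded_right_linear rm)
     \<and> (\<forall>x. continuous_on {0..} (\<lambda>t. T t x))
     \<and> (\<forall>t>0. \<forall>s>0. T (t + s) = T t \<circ> T s)
     \<and> T 0 = id"

definition is_generator ::
    "(real \<Rightarrow> 'x \<Rightarrow> 'x) \<Rightarrow> 'x::real_normed_vector set \<Rightarrow> ('x \<Rightarrow> 'x) \<Rightarrow> bool" where
  "is_generator T D A \<longleftrightarrow>
     D = {x. \<exists>y. ((\<lambda>h. (1 / h) *\<^sub>R (T h x - x)) \<longlongrightarrow> y) (at_right 0)}
     \<and> (\<forall>x\<in>D. ((\<lambda>h. (1 / h) *\<^sub>R (T h x - x)) \<longlongrightarrow> A x) (at_right 0))"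

definition square_domain :: "'x set \<Rightarrow> ('x \<Rightarrow> 'x) \<Rightarrow> 'x set" where
  "square_domain D A = {x \<in> D. A x \<in> D}"

definition Delta ::
    "('a::real_normed_algebra_1 \<Rightarrow> 'a) \<Rightarrow> ('x::real_vector \<Rightarrow> 'x) \<Rightarrow> 'a \<Rightarrow> 'x \<Rightarrow> 'x" where
  "Delta cj A q x = A (A x) - (2 * re_part cj q) *\<^sub>R A x + (norm q)\<^sup>2 *\<^sub>R x"

definition quasi_resolvent ::
    "('a::real_normed_algebra_1 \<Rightarrow> 'a) \<Rightarrow> 'x set \<Rightarrow> ('x::real_vector \<Rightarrow> 'x) \<Rightarrow> 'a \<Rightarrow> 'x \<Rightarrow> 'x" where
  "quasi_resolvent cj D A q = inv_into (square_domain D A) (Delta cj A q)"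

definition spherical_resolvent_set ::
    "('a::real_normed_algebra_1 \<Rightarrow> 'a) \<Rightarrow> ('x::real_normed_vector \<Rightarrow> 'a \<Rightarrow> 'x) \<Rightarrow>
      'x set \<Rightarrow> ('x \<Rightarrow> 'x) \<Rightarrow> 'a set" where
  "spherical_resolvent_set cj rm D A =
     {q \<in> quadratic_cone cj. bij_betw (Delta cj A q) (square_domain D A) UNIV
        \<and> quasi_resolvent cj D A q \<in> bounded_right_linear rm}"

end

theory Submission
  imports Defs "HOL-Real_Asymp.Real_Asymp"
begin

text \<open>
  Write \<open>q = a + b j\<close> with an imaginary unit \<open>j\<close>, so that \<open>Re q = a\<close> and \<open>|q|\<^sup>2 = a\<^sup>2 + b\<^sup>2\<close>. By Euler's
  formula in the slice of \<open>j\<close>, \<open>exp'\<^sub>s(-t, q)\<close> is the \<^emph>\<open>real\<close> number \<open>- exp (- a t) sin (b t) / b\<close>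
  (lemma \<open>exp_s'_eq\<close>), with \<open>t\<close> in place of \<open>sin (b t) / b\<close> if \<open>b = 0\<close>. The convolution powers are therefore real as well, up to the sign \<open>(-1)\<^sup>n\<close> they
  are the convolution powers \<open>p\<^sub>n\<close> of the damped sine, and the theorem becomes a statement about a
  strongly continuous semigroup on a real Banach space.

  For a real kernel \<open>k\<close> put \<open>L k x = \<integral>\<^sub>0\<^sup>\<infinity> k(t) T(t) x dt\<close>. The heart of the proof is the integration by
  parts \<open>A (L k x) = - k(0) x - L k' x\<close> (lemma \<open>generator_laplace\<close>). It turns a differential equation for
  the kernel into an equation for the generator. The damped sine is the Green's function of
  \<open>p'' + 2 a p' + (a\<^sup>2 + b\<^sup>2) p\<close>: it solves the homogeneous equation with \<open>p(0) = 0\<close>, \<open>p'(0) = 1\<close>, and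
  convolution with it solves the inhomogeneous equation with zero initial data. Hence
  \<open>\<Delta>\<^sub>q L p\<^sub>1 = Id\<close> and \<open>\<Delta>\<^sub>q L p\<^bsub>n+1\<^esub> = L p\<^sub>n\<close> (lemma \<open>quadratic_laplace_oscillator\<close>). As \<open>L p\<^sub>1\<close> commutes with
  \<open>A\<close> on its domain, it is also a left inverse of \<open>\<Delta>\<^sub>q\<close>, and so \<open>Q\<^sub>q\<^sup>n = L p\<^sub>n\<close> (lemma
  \<open>quadratic_resolvent\<close>).

  The norm estimate uses the formula for the \<open>n\<close>-th power, not the estimate for \<open>n = 1\<close>, which would
  produce \<open>M\<^sup>n\<close>: by induction \<open>|p\<^sub>n(t)| \<le> exp (- a t) t\<^bsup>2n-1\<^esup> / (2n-1)!\<close>, and the Gamma integral of this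
  bound against \<open>M exp (\<omega> t)\<close> is \<open>M / (a - \<omega>)\<^bsup>2n\<^esup>\<close>.

  All integrands are continuous and decay exponentially. Their integrals are therefore limits of
  integrals over compact intervals, and these limits are Bochner integrals, in a possibly inseparable
  module, by approximation with step functions (lemma \<open>has_bochner_half_line_integral\<close>).
\<close>

section \<open>Bochner integrals without separability\<close>

text \<open>
  Without separability a difference of measurable functions need not be measurable. Here it is,
  because \<open>s\<close> has finitely many values and \<open>norm (f t - v)\<close> is measurable for each fixed value \<open>v\<close>.
\<close>

lemma borel_measurable_norm_diff_simple:
  fixes f s :: "'b \<Rightarrow> 'x::real_normed_vector"
  assumes f: "f \<in> borel_measurable M" and s: "simple_function M s"
  shows "(\<lambda>t. norm (f t - s t)) \<in> borel_measurable M"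
proof (rule measurable_compose_countable'[where f = "\<lambda>v t. norm (f t - v)" and g = s and I = "s ` space M"])
  fix v :: 'x
  have "(\<lambda>y. norm (y - v)) \<in> borel_measurable borel"
    by (intro borel_measurable_continuous_onI continuous_intros)
  from measurable_compose[OF f this] show "(\<lambda>t. norm (f t - v)) \<in> borel_measurable M" .
next
  show "s \<in> measurable M (count_space (s ` space M))"
    using s by (auto simp: simple_function_def measurable_count_space_eq2)
  show "countable (s ` space M)"
    using s by (intro countable_finite) (auto simp: simple_function_def)
qed

text \<open>
  The integrals of two approximating sequences of simple functions differ by at most the sum of
  their \<open>L\<^sup>1\<close>-distances to \<open>f\<close>.
\<close>

lemma has_bochner_unique:
  fixes f :: "'b \<Rightarrow> 'x::real_normed_vector"
  assumes "has_bochner M f I" "has_bochner M f J"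
  shows "I = J"
proof -
  from assms(1) obtain s where f: "f \<in> borel_measurable M"
    and s: "\<And>i. Bochner_Integration.simple_bochner_integrable M (s i)"
    and sf: "(\<lambda>i. \<integral>\<^sup>+x. norm (f x - s i x) \<partial>M) \<longlonglongrightarrow> 0"
    and sI: "(\<lambda>i. Bochner_Integration.simple_bochner_integral M (s i)) \<longlonglongrightarrow> I"
    by (rule has_bochner.cases) blast
  from assms(2) obtain t where
        t: "\<And>i. Bochner_Integration.simple_bochner_integrable M (t i)"
    and tf: "(\<lambda>i. \<integral>\<^sup>+x. norm (f x - t i x) \<partial>M) \<longlonglongrightarrow> 0"
    and tJ: "(\<lambda>i. Bochner_Integration.simple_bochner_integral M (t i)) \<longlonglongrightarrow> J"
    by (rule has_bochner.cases) blast
  note [measurable] = borel_measurable_norm_diff_simple[OF f]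
  let ?s = "\<lambda>i. Bochner_Integration.simple_bochner_integral M (s i)"
  let ?t = "\<lambda>i. Bochner_Integration.simple_bochner_integral M (t i)"
  have bound: "ennreal (norm (?s i - ?t i)) \<le>
      (\<integral>\<^sup>+x. norm (f x - s i x) \<partial>M) + (\<integral>\<^sup>+x. norm (f x - t i x) \<partial>M)" for i
  proof -
    have sf': "simple_function M (s i)" "simple_function M (t i)"
      using s[of i] t[of i] by (auto elim: Bochner_Integration.simple_bochner_integrable.cases)
    have st: "Bochner_Integration.simple_bochner_integrable M (\<lambda>x. s i x - t i x)"
      using s[of i] t[of i] by (rule Bochner_Integration.simple_bochner_integrable_compose2[rotated]) simp
    have st': "Bochner_Integration.simple_bochner_integrable M (\<lambda>x. norm (s i x - t i x))"
      using st st by (rule Bochner_Integration.simple_bochner_integrable_compose2[rotated, where p="\<lambda>x y. norm x"]) simp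
    have "ennreal (norm (?s i - ?t i))
        \<le> Bochner_Integration.simple_bochner_integral M (\<lambda>x. norm (s i x - t i x))"
      using Bochner_Integration.simple_bochner_integral_norm_bound[OF st]
      by (simp add: Bochner_Integration.simple_bochner_integral_diff[OF s t] ennreal_leI)
    also have "\<dots> = (\<integral>\<^sup>+x. norm (s i x - t i x) \<partial>M)"
      by (rule Bochner_Integration.simple_bochner_integral_eq_nn_integral[OF st']) simp
    also have "\<dots> \<le> (\<integral>\<^sup>+x. ennreal (norm (f x - s i x)) + ennreal (norm (f x - t i x)) \<partial>M)"
    proof (rule nn_integral_mono)
      fix x
      have "norm (s i x - t i x) \<le> norm (f x - s i x) + norm (f x - t i x)"
        by norm
      then show "ennreal (norm (s i x - t i x)) \<le> ennreal (norm (f x - s i x)) + ennreal (norm (f x - t i x))"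
        by (metis ennreal_leI ennreal_plus norm_ge_zero)
    qed
    also have "\<dots> = (\<integral>\<^sup>+x. norm (f x - s i x) \<partial>M) + (\<integral>\<^sup>+x. norm (f x - t i x) \<partial>M)"
      by (rule nn_integral_add) (use sf' in measurable)
    finally show ?thesis .
  qed
  have "(\<lambda>i. ennreal (norm (?s i - ?t i))) \<longlonglongrightarrow> 0"
    using tendsto_const tendsto_add[OF sf tf, simplified]
    by (rule tendsto_sandwich[rotated 2]) (use bound in auto)
  then have "(\<lambda>i. norm (?s i - ?t i)) \<longlonglongrightarrow> 0"
    by (simp add: tendsto_ennreal_iff flip: ennreal_0)
  moreover have "(\<lambda>i. norm (?s i - ?t i)) \<longlonglongrightarrow> norm (I - J)"
    using sI tJ by (intro tendsto_intros)
  ultimately have "norm (I - J) = 0"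
    using LIMSEQ_unique by blast
  then show ?thesis by simp
qed

lemma bochner_integral_eqI:
  "has_bochner M f I \<Longrightarrow> bochner_integral M f = I"
  unfolding bochner_integral_def using has_bochner_unique by blast

text \<open>
  This comparison of simple integrals with gauge integrals lets the limit of the Bochner
  approximations be identified by calculus on compact intervals.
\<close>

lemma simple_bochner_integral_has_integral:
  fixes s :: "'e::euclidean_space \<Rightarrow> 'x::real_normed_vector"
  assumes s: "Bochner_Integration.simple_bochner_integrable (lebesgue_on S) s"
    and S: "S \<in> sets lebesgue"
  shows "(s has_integral Bochner_Integration.simple_bochner_integral (lebesgue_on S) s) S"
proof -
  from s have sf: "simple_function (lebesgue_on S) s"
    and fin: "emeasure (lebesgue_on S) {y \<in> S. s y \<noteq> 0} \<noteq> \<infinity>"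
    by (auto elim: Bochner_Integration.simple_bochner_integrable.cases)
  have fin_im: "finite (s ` S)"
    using sf by (simp add: simple_function_def)
  have piece: "((\<lambda>t. indicator {t \<in> S. s t = y} t *\<^sub>R y) has_integral
      measure (lebesgue_on S) {t \<in> S. s t = y} *\<^sub>R y) S" if "y \<in> s ` S" for y
  proof (cases "y = 0")
    case False
    let ?E = "{t \<in> S. s t = y}"
    have "s -` {y} \<inter> space (lebesgue_on S) \<in> sets (lebesgue_on S)"
      using sf that by (auto simp: simple_function_def)
    moreover have "s -` {y} \<inter> space (lebesgue_on S) = ?E"
      by auto
    ultimately have E: "?E \<in> sets (lebesgue_on S)" by simp
    have E': "?E \<in> sets lebesgue"
      using E S by (auto simp: sets_restrict_space_iff)
    have supp: "{t \<in> S. s t \<noteq> 0} \<in> sets (lebesgue_on S)"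
    proof -
      have "{t \<in> S. s t \<noteq> 0} = s -` (- {0}) \<inter> space (lebesgue_on S)" by auto
      also have "\<dots> \<in> sets (lebesgue_on S)"
        using simple_functionD(2)[OF sf] .
      finally show ?thesis .
    qed
    have "emeasure (lebesgue_on S) ?E \<le> emeasure (lebesgue_on S) {t \<in> S. s t \<noteq> 0}"
      by (rule emeasure_mono[OF _ supp]) (use False in blast)
    with fin have "emeasure (lebesgue_on S) ?E < \<infinity>"
      by (auto simp: less_top[symmetric] top_unique)
    moreover have eq: "emeasure (lebesgue_on S) ?E = emeasure lebesgue ?E"
      "measure (lebesgue_on S) ?E = measure lebesgue ?E"
      using S by (auto simp: emeasure_restrict_space measure_restrict_space)
    ultimately have "?E \<in> lmeasurable"
      using E' by (intro fmeasurableI) auto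
    then have "((indicator ?E :: _ \<Rightarrow> real) has_integral measure lebesgue ?E) UNIV"
      using lmeasurable_iff_has_integral by blast
    then have "((\<lambda>t. if t \<in> S then indicator ?E t else (0::real)) has_integral measure lebesgue ?E) UNIV"
      by (rule has_integral_eq[rotated]) (auto simp: indicator_def)
    then have "((indicator ?E :: _ \<Rightarrow> real) has_integral measure lebesgue ?E) S"
      by (simp add: has_integral_restrict_UNIV)
    from has_integral_scaleR_left[OF this] eq show ?thesis by simp
  qed simp
  have "((\<lambda>t. \<Sum>y\<in>s ` S. indicator {t \<in> S. s t = y} t *\<^sub>R y) has_integral
      (\<Sum>y\<in>s ` S. measure (lebesgue_on S) {t \<in> S. s t = y} *\<^sub>R y)) S"
    using fin_im piece by (rule has_integral_sum)
  then have "(s has_integral (\<Sum>y\<in>s ` S. measure (lebesgue_on S) {t \<in> S. s t = y} *\<^sub>R y)) S"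
  proof (rule has_integral_eq[rotated])
    fix t assume t: "t \<in> S"
    have "(\<Sum>y\<in>s ` S. indicator {t \<in> S. s t = y} t *\<^sub>R y) = (\<Sum>y\<in>s ` S. if y = s t then y else 0)"
      using t by (intro sum.cong) (auto simp: indicator_def)
    also have "\<dots> = s t"
      using t fin_im by simp
    finally show "(\<Sum>y\<in>s ` S. indicator {t \<in> S. s t = y} t *\<^sub>R y) = s t" .
  qed
  then show ?thesis
    by (simp add: Bochner_Integration.simple_bochner_integral_def)
qed

text \<open>
  Uniform continuity on \<open>[0, N]\<close> makes the values at the left endpoints of a fine grid a good
  approximation, and such a step function has finitely many values.
\<close>

lemma continuous_step_approximation:
  fixes f :: "real \<Rightarrow> 'x::real_normed_vector"
  assumes f: "continuous_on {0..} f" and N: "N \<ge> 0" and e: "e > 0"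
  obtains s where "Bochner_Integration.simple_bochner_integrable (lebesgue_on {0..}) s"
    and "\<And>t. t \<in> {0..N} \<Longrightarrow> norm (f t - s t) \<le> e" and "\<And>t. t > N \<Longrightarrow> s t = 0"
proof -
  have "uniformly_continuous_on {0..N} f"
    by (intro compact_uniformly_continuous continuous_on_subset[OF f]) auto
  then obtain d where d: "d > 0"
    "\<And>t t'. t \<in> {0..N} \<Longrightarrow> t' \<in> {0..N} \<Longrightarrow> dist t' t < d \<Longrightarrow> dist (f t') (f t) < e"
    unfolding uniformly_continuous_on_def using e by metis
  obtain m :: nat where m: "m > 0" "1 / real m < d"
    using d(1) by (metis nat_approx_posE zero_less_Suc)
  \<comment> \<open>The index of the grid cell of \<open>t\<close>; the value \<open>-1\<close> marks the points beyond \<open>N\<close>.\<close>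
  define u where "u t = (if t \<le> N then \<lfloor>real m * t\<rfloor> else -1)" for t :: real
  define v where "v k = (if k < 0 then 0 else f (real_of_int k / real m))" for k :: int
  define s where "s t = v (u t)" for t
  have "simple_function (lebesgue_on {0..}) u"
  proof -
    have im: "u ` {0..} \<subseteq> {-1..\<lceil>real m * N\<rceil>}"
    proof (rule image_subsetI)
      fix t :: real assume "t \<in> {0..}"
      then have "0 \<le> real m * t" "t \<le> N \<Longrightarrow> real m * t \<le> real m * N" "0 \<le> real m * N"
        using N by (auto intro: mult_left_mono)
      then have "u t \<ge> -1" "u t \<le> \<lceil>real m * N\<rceil>"
        unfolding u_def by (simp_all split: if_splits) linarith+
      then show "u t \<in> {-1..\<lceil>real m * N\<rceil>}" by simp
    qed
    have "u \<in> measurable borel (count_space UNIV)"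
      unfolding u_def by measurable
    then have "u -` {k} \<in> sets borel" for k
      using measurable_sets[of u borel "count_space UNIV" "{k}"] by simp
    then have "u -` {k} \<inter> {0..} \<in> sets (lebesgue_on {0..})" for k
      by (auto simp: sets_restrict_space_iff)
    then show ?thesis
      using finite_subset[OF im] by (auto simp: simple_function_def)
  qed
  from simple_function_compose1[OF this, of v] have sf: "simple_function (lebesgue_on {0..}) s"
    by (simp add: s_def[abs_def])
  have s0: "s t = 0" if "t > N" for t
    using that by (simp add: s_def u_def v_def)
  have "emeasure (lebesgue_on {0..}) {t \<in> {0..}. s t \<noteq> 0} \<le> emeasure (lebesgue_on {0..}) {0..N}"
    using s0 by (intro emeasure_mono) (force simp: sets_restrict_space_iff not_less)+
  also have "\<dots> = ennreal N"
    using N by (subst emeasure_restrict_space) auto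
  finally have "emeasure (lebesgue_on {0..}) {t \<in> {0..}. s t \<noteq> 0} \<noteq> \<infinity>"
    by (auto simp: top_unique)
  with sf have "Bochner_Integration.simple_bochner_integrable (lebesgue_on {0..}) s"
    by (intro Bochner_Integration.simple_bochner_integrable.intros) auto
  moreover have "norm (f t - s t) \<le> e" if t: "t \<in> {0..N}" for t
  proof -
    define t' where "t' = real_of_int \<lfloor>real m * t\<rfloor> / real m"
    have fl: "0 \<le> real m * t" using t by simp
    have "s t = f t'"
    proof -
      have "u t = \<lfloor>real m * t\<rfloor>" "\<not> \<lfloor>real m * t\<rfloor> < 0"
        using t fl by (simp_all only: u_def atLeastAtMost_iff if_True not_less zero_le_floor)
      then show ?thesis by (simp only: s_def v_def t'_def if_False)
    qed
    moreover have "0 \<le> t'" "t' \<le> t" "t - t' < d"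
    proof -
      show "0 \<le> t'" using fl by (simp add: t'_def)
      show "t' \<le> t" using m by (simp add: t'_def field_simps)
      have "real m * t - 1 < real_of_int \<lfloor>real m * t\<rfloor>" by linarith
      then have "(real m * t - 1) / real m < t'"
        using m by (simp only: t'_def divide_strict_right_mono of_nat_0_less_iff)
      then have "t - 1 / real m < t'" using m by (simp add: diff_divide_distrib)
      then show "t - t' < d" using m by linarith
    qed
    ultimately show ?thesis
      using d(2)[of t t'] t by (auto simp: dist_norm norm_minus_commute)
  qed
  ultimately show thesis using that s0 by blast
qed

section \<open>Exponentially decaying functions on the half-line\<close>

definition exp_decaying :: "real \<Rightarrow> (real \<Rightarrow> 'x::real_normed_vector) \<Rightarrow> bool" where
  "exp_decaying c f \<longleftrightarrow>
     continuous_on {0..} f \<and> (\<exists>C. \<forall>t\<ge>0. norm (f t) \<le> C * exp (- (c * t)))"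

text \<open>
  The integral is taken as an improper integral of continuous functions: for the Banach spaces at
  hand, calculus (the fundamental theorem, integration of bounded operators) is available for the
  gauge integral on compact intervals, and the passage to the half-line is a limit.
\<close>

definition half_line_integral :: "(real \<Rightarrow> 'x::banach) \<Rightarrow> 'x" where
  "half_line_integral f = Lim at_top (\<lambda>N. integral {0..N} f)"

lemma exp_decayingE:
  assumes "exp_decaying c f"
  obtains C where "C \<ge> 0" "\<And>t. t \<ge> 0 \<Longrightarrow> norm (f t) \<le> C * exp (- (c * t))"
proof -
  from assms obtain C where C: "\<And>t. t \<ge> 0 \<Longrightarrow> norm (f t) \<le> C * exp (- (c * t))"
    by (auto simp: exp_decaying_def)
  have "C \<ge> 0" using order_trans[OF norm_ge_zero C[of 0]] by simp
  from this C show thesis by (rule that)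
qed

lemma exp_decaying_continuous: "exp_decaying c f \<Longrightarrow> continuous_on {0..} f"
  by (simp add: exp_decaying_def)

lemma continuous_integrable_on:
  "continuous_on {0..} f \<Longrightarrow> 0 \<le> a \<Longrightarrow> f integrable_on {a..b}"
  for f :: "real \<Rightarrow> 'x::banach"
  by (rule integrable_continuous_real, erule continuous_on_subset) auto

lemma has_integral_exp_decay:
  fixes c :: real
  assumes "c > 0" "a \<le> b"
  shows "((\<lambda>t. C * exp (- (c * t))) has_integral C * (exp (- (c * a)) - exp (- (c * b))) / c) {a..b}"
proof -
  have "((\<lambda>t. C * exp (- (c * t))) has_integral
      (- C / c * exp (- (c * b))) - (- C / c * exp (- (c * a)))) {a..b}"
    by (rule fundamental_theorem_of_calculus)
      (use assms in \<open>auto intro!: derivative_eq_intros simp: has_real_derivative_iff_has_vector_derivative[symmetric]\<close>)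
  then show ?thesis
    using assms by (simp add: field_simps)
qed

lemma half_line_integral_tail:
  fixes f :: "real \<Rightarrow> 'x::banach"
  assumes f: "continuous_on {0..} f" and c: "c > 0" and C: "C \<ge> 0"
    and bound: "\<And>t. t \<ge> 0 \<Longrightarrow> norm (f t) \<le> C * exp (- (c * t))"
    and ab: "0 \<le> a" "a \<le> b"
  shows "norm (integral {0..b} f - integral {0..a} f) \<le> C / c * exp (- (c * a))"
proof -
  have "integral {0..a} f + integral {a..b} f = integral {0..b} f"
    using ab f by (intro Henstock_Kurzweil_Integration.integral_combine continuous_integrable_on) auto
  then have "norm (integral {0..b} f - integral {0..a} f) = norm (integral {a..b} f)"
    by (metis add_diff_cancel_left')
  also have "\<dots> \<le> integral {a..b} (\<lambda>t. C * exp (- (c * t)))"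
    using ab f
    by (intro integral_norm_bound_integral continuous_integrable_on bound continuous_intros) auto
  also have "\<dots> = C * (exp (- (c * a)) - exp (- (c * b))) / c"
    by (rule integral_unique[OF has_integral_exp_decay[OF c ab(2)]])
  also have "\<dots> \<le> C / c * exp (- (c * a))"
    using c C by (simp add: field_simps)
  finally show ?thesis .
qed

text \<open>
  The exponential bound on the tails makes the truncated integrals a Cauchy family.
\<close>

lemma half_line_integral_tendsto:
  fixes f :: "real \<Rightarrow> 'x::banach"
  assumes f: "exp_decaying c f" and c: "c > 0"
  shows "((\<lambda>N. integral {0..N} f) \<longlongrightarrow> half_line_integral f) at_top"
proof -
  obtain C where C: "C \<ge> 0" "\<And>t. t \<ge> 0 \<Longrightarrow> norm (f t) \<le> C * exp (- (c * t))"
    using f by (rule exp_decayingE) blast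
  have tail: "norm (integral {0..b} f - integral {0..a} f) \<le> C / c * exp (- (c * a))"
    if "0 \<le> a" "a \<le> b" for a b
    using half_line_integral_tail[OF exp_decaying_continuous[OF f] c C(1) _ that] C(2) by blast
  have lim0: "((\<lambda>a. C / c * exp (- (c * a))) \<longlongrightarrow> 0) at_top"
  proof -
    have "((\<lambda>a. exp (- (c * a))) \<longlongrightarrow> 0) at_top"
      using c by (intro filterlim_compose[OF exp_at_bot] filterlim_uminus_at_bot_at_top[THEN filterlim_compose]
          filterlim_tendsto_pos_mult_at_top[OF tendsto_const _ filterlim_ident])
    from tendsto_mult_right_zero[OF this] show ?thesis .
  qed
  have "Cauchy (\<lambda>n. integral {0..real n} f)"
  proof (rule metric_CauchyI)
    fix e :: real assume "e > 0"
    with lim0 have "eventually (\<lambda>a. C / c * exp (- (c * a)) < e / 2) at_top"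
      by (intro order_tendstoD) auto
    then obtain a0 where a0: "\<And>a. a \<ge> a0 \<Longrightarrow> C / c * exp (- (c * a)) < e / 2"
      by (auto simp: eventually_at_top_linorder)
    define n0 where "n0 = nat \<lceil>\<bar>a0\<bar>\<rceil>"
    have "real n0 \<ge> a0" "real n0 \<ge> 0" by (auto simp: n0_def) linarith
    then have *: "norm (integral {0..real n} f - integral {0..real n0} f) < e / 2" if "n \<ge> n0" for n
    proof -
      have "norm (integral {0..real n} f - integral {0..real n0} f) \<le> C / c * exp (- (c * real n0))"
        using tail[of "real n0" "real n"] that by simp
      also have "\<dots> < e / 2" using a0 \<open>real n0 \<ge> a0\<close> by blast
      finally show ?thesis .
    qed
    show "\<exists>M. \<forall>m\<ge>M. \<forall>n\<ge>M. dist (integral {0..real m} f) (integral {0..real n} f) < e"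
    proof (intro exI allI impI)
      fix m n assume "n0 \<le> m" "n0 \<le> n"
      from *[OF this(1)] *[OF this(2)]
      show "dist (integral {0..real m} f) (integral {0..real n} f) < e" by norm
    qed
  qed
  then obtain I where I: "(\<lambda>n. integral {0..real n} f) \<longlonglongrightarrow> I"
    using Cauchy_convergent_iff convergent_def by blast
  have "norm (integral {0..a} f - I) \<le> C / c * exp (- (c * a))" if "a \<ge> 0" for a
  proof (rule tendsto_upperbound)
    show "(\<lambda>n. norm (integral {0..a} f - integral {0..real n} f)) \<longlonglongrightarrow> norm (integral {0..a} f - I)"
      by (intro tendsto_intros I)
    show "eventually (\<lambda>n. norm (integral {0..a} f - integral {0..real n} f) \<le> C / c * exp (- (c * a))) sequentially"
    proof (rule eventually_sequentiallyI[of "nat \<lceil>a\<rceil>"])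
      fix n assume "nat \<lceil>a\<rceil> \<le> n"
      then have "a \<le> real n" by linarith
      from tail[OF that this] show "norm (integral {0..a} f - integral {0..real n} f) \<le> C / c * exp (- (c * a))"
        by (simp only: norm_minus_commute)
    qed
  qed simp
  then have "\<forall>\<^sub>F a in at_top. norm (integral {0..a} f - I) \<le> C / c * exp (- (c * a))"
    by (rule eventually_at_top_linorderI)
  from Lim_null_comparison[OF this lim0] have "((\<lambda>a. integral {0..a} f) \<longlongrightarrow> I) at_top"
    by (rule Lim_null[THEN iffD2])
  moreover from this have "half_line_integral f = I"
    unfolding half_line_integral_def by (rule tendsto_Lim[OF trivial_limit_at_top_linorder])
  ultimately show ?thesis by (simp only:)
qed

lemma norm_half_line_integral_le:
  fixes f :: "real \<Rightarrow> 'x::banach"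
  assumes f: "exp_decaying c f" and c: "c > 0"
    and g: "continuous_on {0..} g" "\<And>t. t \<ge> 0 \<Longrightarrow> norm (f t) \<le> g t"
    and B: "\<And>N. N \<ge> 0 \<Longrightarrow> integral {0..N} g \<le> B"
  shows "norm (half_line_integral f) \<le> B"
proof (rule tendsto_upperbound)
  show "((\<lambda>N. norm (integral {0..N} f)) \<longlongrightarrow> norm (half_line_integral f)) at_top"
    by (intro tendsto_norm half_line_integral_tendsto[OF f c])
  show "\<forall>\<^sub>F N in at_top. norm (integral {0..N} f) \<le> B"
  proof (rule eventually_at_top_linorderI[of 0])
    fix N :: real assume "N \<ge> 0"
    have "norm (integral {0..N} f) \<le> integral {0..N} g"
      using exp_decaying_continuous[OF f] g
      by (intro integral_norm_bound_integral continuous_integrable_on) auto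
    also have "\<dots> \<le> B" using B \<open>N \<ge> 0\<close> by blast
    finally show "norm (integral {0..N} f) \<le> B" .
  qed
qed simp

text \<open>
  Approximate \<open>f\<close> on \<open>[0, i]\<close> by a step function with error \<open>1/(i+1)\<^sup>2\<close>, so that the total
  error \<open>i/(i+1)\<^sup>2\<close> on the growing interval still vanishes; the tail is controlled by the decay.
\<close>

lemma has_bochner_half_line_integral:
  fixes f :: "real \<Rightarrow> 'x::banach"
  assumes f: "exp_decaying c f" and c: "c > 0"
  shows "has_bochner (lebesgue_on {0..}) f (half_line_integral f)"
proof -
  obtain C where C: "C \<ge> 0" "\<And>t. t \<ge> 0 \<Longrightarrow> norm (f t) \<le> C * exp (- (c * t))"
    using f by (rule exp_decayingE) blast
  have cont: "continuous_on {0..} f"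
    using f by (rule exp_decaying_continuous)
  define e where "e i = 1 / (real i + 1)\<^sup>2" for i
  have "\<exists>s. Bochner_Integration.simple_bochner_integrable (lebesgue_on {0..}) s
      \<and> (\<forall>t\<in>{0..real i}. norm (f t - s t) \<le> e i) \<and> (\<forall>t>real i. s t = 0)" for i
    by (rule continuous_step_approximation[OF cont, of "real i" "e i"]) (auto simp: e_def)
  then obtain s where s: "\<And>i. Bochner_Integration.simple_bochner_integrable (lebesgue_on {0..}) (s i)"
    and near: "\<And>i t. t \<in> {0..real i} \<Longrightarrow> norm (f t - s i t) \<le> e i"
    and zero: "\<And>i t. t > real i \<Longrightarrow> s i t = 0"
    by metis
  have e0: "e i \<ge> 0" for i by (simp add: e_def)
  have e_lim: "(\<lambda>i. e i * real i) \<longlonglongrightarrow> 0"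
    unfolding e_def by real_asymp
  have err: "(\<integral>\<^sup>+t. norm (f t - s i t) \<partial>lebesgue_on {0..}) \<le> ennreal (e i * real i + C / c * exp (- (c * real i)))" for i
  proof -
    define g where "g t = (if t \<le> real i then e i else C * exp (- (c * t)))" for t
    have "((\<lambda>t. e i) has_integral e i * real i) {0..real i}"
      using has_integral_const_real[of "e i" 0 "real i"] by (simp add: mult.commute)
    then have "(g has_integral e i * real i) {0..real i}"
      by (rule has_integral_eq[rotated]) (simp add: g_def)
    moreover have "((\<lambda>t. exp (- c * t)) has_integral exp (- c * real i) / c) {real i..}"
      using c by (rule has_integral_exp_minus_to_infinity)
    then have "((\<lambda>t. C * exp (- c * t)) has_integral C * (exp (- c * real i) / c)) {real i..}"
      by (rule has_integral_mult_right)
    then have "(g has_integral C * (exp (- c * real i) / c)) {real i..}"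
      by (rule has_integral_spike[OF negligible_sing[of "real i"], rotated]) (auto simp: g_def)
    ultimately have "(g has_integral e i * real i + C * (exp (- c * real i) / c)) ({0..real i} \<union> {real i..})"
      by (rule has_integral_Un) (rule negligible_subset[OF negligible_sing[of "real i"]], auto)
    moreover have "{0..real i} \<union> {real i..} = {0..}" by auto
    ultimately have g: "(g has_integral e i * real i + C / c * exp (- (c * real i))) {0..}"
      by simp
    have "(\<integral>\<^sup>+t. norm (f t - s i t) \<partial>lebesgue_on {0..}) \<le> (\<integral>\<^sup>+t. g t \<partial>lebesgue_on {0..})"
    proof (rule nn_integral_mono)
      fix t assume "t \<in> space (lebesgue_on {0::real..})"
      then show "ennreal (norm (f t - s i t)) \<le> ennreal (g t)"
        using near[of t i] zero[of i t] C(2)[of t] by (intro ennreal_leI) (auto simp: g_def not_le)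
    qed
    also have "\<dots> = (\<integral>\<^sup>+t. ennreal (g t) * indicator {0..} t \<partial>lebesgue)"
      by (subst nn_integral_restrict_space) auto
    also have "\<dots> = (\<integral>\<^sup>+t. ennreal (indicator {0..} t * g t) \<partial>lebesgue)"
      by (intro nn_integral_cong) (auto simp: indicator_def)
    also have "\<dots> = (\<integral>\<^sup>+t. ennreal (indicator {0..} t * g t) \<partial>lborel)"
      by (rule nn_integral_completion)
    also have "\<dots> = ennreal (e i * real i + C / c * exp (- (c * real i)))"
      by (rule nn_integral_has_integral_lebesgue[OF _ g]) (use C e0 in \<open>auto simp: g_def\<close>)
    finally show ?thesis .
  qed
  show ?thesis
  proof
    show "f \<in> borel_measurable (lebesgue_on {0..})"
      by (rule continuous_imp_measurable_on_sets_lebesgue[OF cont]) simp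
    show "Bochner_Integration.simple_bochner_integrable (lebesgue_on {0..}) (s i)" for i
      by (rule s)
    have "(\<lambda>i. exp (- (c * real i))) \<longlonglongrightarrow> 0"
      using c by real_asymp
    then have "(\<lambda>i. e i * real i + C / c * exp (- (c * real i))) \<longlonglongrightarrow> 0 + C / c * 0"
      using e_lim by (intro tendsto_intros)
    then have "(\<lambda>i. ennreal (e i * real i + C / c * exp (- (c * real i)))) \<longlonglongrightarrow> 0"
      by (metis add_0 ennreal_0 mult_zero_right tendsto_ennrealI)
    then show "(\<lambda>i. \<integral>\<^sup>+t. norm (f t - s i t) \<partial>lebesgue_on {0..}) \<longlonglongrightarrow> 0"
      by (rule tendsto_sandwich[rotated 3, OF _ _ _ ]) (use err in auto)
    let ?I = "\<lambda>i. Bochner_Integration.simple_bochner_integral (lebesgue_on {0..}) (s i)"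
    have close: "norm (integral {0..real i} f - ?I i) \<le> e i * real i" for i
    proof -
      have "(s i has_integral ?I i) {0..}"
        by (rule simple_bochner_integral_has_integral[OF s]) simp
      then have "((\<lambda>t. if t \<in> {0..} then s i t else 0) has_integral ?I i) UNIV"
        by (simp only: has_integral_restrict_UNIV)
      moreover have "(\<lambda>t. if t \<in> {0..} then s i t else 0) = (\<lambda>t. if t \<in> {0..real i} then s i t else 0)"
        using zero[of i] by (auto simp: fun_eq_iff not_le)
      ultimately have si: "(s i has_integral ?I i) {0..real i}"
        by (simp only: has_integral_restrict_UNIV)
      have fi: "(f has_integral integral {0..real i} f) {0..real i}"
        by (intro integrable_integral continuous_integrable_on cont) simp
      have "norm (integral {0..real i} (\<lambda>t. f t - s i t)) \<le> integral {0..real i} (\<lambda>t. e i)"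
        using has_integral_diff[OF fi si] near
        by (intro integral_norm_bound_integral) (auto simp: integrable_on_def)
      then show ?thesis
        using integral_unique[OF has_integral_diff[OF fi si]] by (simp add: mult.commute)
    qed
    have "(\<lambda>i. integral {0..real i} f - ?I i) \<longlonglongrightarrow> 0"
      by (rule Lim_null_comparison[OF _ e_lim]) (use close in auto)
    moreover have "(\<lambda>i. integral {0..real i} f) \<longlonglongrightarrow> half_line_integral f"
      by (rule filterlim_compose[OF half_line_integral_tendsto[OF f c] filterlim_real_sequentially])
    ultimately have "(\<lambda>i. integral {0..real i} f - (integral {0..real i} f - ?I i))
        \<longlonglongrightarrow> half_line_integral f - 0"
      by (intro tendsto_diff)
    then show "?I \<longlonglongrightarrow> half_line_integral f"
      by simp
  qed
qed

lemma exp_decaying_add: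
  assumes "exp_decaying c f" "exp_decaying c g"
  shows "exp_decaying c (\<lambda>t. f t + g t)"
proof -
  obtain C C' where "\<And>t. t \<ge> 0 \<Longrightarrow> norm (f t) \<le> C * exp (- (c * t))"
    "\<And>t. t \<ge> 0 \<Longrightarrow> norm (g t) \<le> C' * exp (- (c * t))"
    using assms by (auto simp: exp_decaying_def)
  then have "norm (f t + g t) \<le> (C + C') * exp (- (c * t))" if "t \<ge> 0" for t
    using that by (intro order_trans[OF norm_triangle_ineq]) (auto simp: distrib_right intro!: add_mono)
  with assms show ?thesis
    unfolding exp_decaying_def by (blast intro: continuous_on_add)
qed

lemma exp_decaying_bounded_linear:
  assumes "bounded_linear L" "exp_decaying c f"
  shows "exp_decaying c (\<lambda>t. L (f t))"
proof -
  interpret bounded_linear L by fact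
  obtain C where C: "\<And>t. t \<ge> 0 \<Longrightarrow> norm (f t) \<le> C * exp (- (c * t))"
    using assms by (auto simp: exp_decaying_def)
  obtain K where K: "K \<ge> 0" "\<And>x. norm (L x) \<le> norm x * K"
    using nonneg_bounded by blast
  have "norm (L (f t)) \<le> (C * K) * exp (- (c * t))" if "t \<ge> 0" for t
    using K(2)[of "f t"] mult_right_mono[OF C[OF that] K(1)] by (simp add: mult_ac)
  then show ?thesis
    using assms continuous_on[of "{0..}" f] by (auto simp: exp_decaying_def)
qed

lemma exp_decaying_scale:
  fixes f :: "real \<Rightarrow> real"
  shows "exp_decaying c f \<Longrightarrow> exp_decaying c (\<lambda>t. r * f t)"
  using exp_decaying_bounded_linear[OF bounded_linear_mult_right] .

lemma half_line_integral_eqI: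
  assumes "((\<lambda>N. integral {0..N} f) \<longlongrightarrow> I) at_top"
  shows "half_line_integral f = I"
  unfolding half_line_integral_def by (rule tendsto_Lim[OF trivial_limit_at_top_linorder assms])

lemma half_line_integral_cong:
  assumes "\<And>t. t \<ge> 0 \<Longrightarrow> f t = g t"
  shows "half_line_integral f = half_line_integral g"
proof -
  have "integral {0..N} f = integral {0..N} g" for N
    using assms by (intro integral_cong) auto
  then show ?thesis by (simp add: half_line_integral_def)
qed

lemma half_line_integral_add:
  fixes f g :: "real \<Rightarrow> 'x::banach"
  assumes f: "exp_decaying c f" and g: "exp_decaying c g" and c: "c > 0"
  shows "half_line_integral (\<lambda>t. f t + g t) = half_line_integral f + half_line_integral g"
proof (rule half_line_integral_eqI)
  have "integral {0..N} (\<lambda>t. f t + g t) = integral {0..N} f + integral {0..N} g" for N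
    by (rule integral_add; rule continuous_integrable_on)
      (use f g in \<open>auto intro: exp_decaying_continuous\<close>)
  then show "((\<lambda>N. integral {0..N} (\<lambda>t. f t + g t)) \<longlongrightarrow> half_line_integral f + half_line_integral g) at_top"
    using tendsto_add[OF half_line_integral_tendsto[OF f c] half_line_integral_tendsto[OF g c]]
    by simp
qed

lemma half_line_integral_bounded_linear:
  fixes f :: "real \<Rightarrow> 'x::banach" and L :: "'x \<Rightarrow> 'y::banach"
  assumes L: "bounded_linear L" and f: "exp_decaying c f" and c: "c > 0"
  shows "half_line_integral (\<lambda>t. L (f t)) = L (half_line_integral f)"
proof (rule half_line_integral_eqI)
  have "integral {0..N} (\<lambda>t. L (f t)) = L (integral {0..N} f)" for N
    using integral_linear[OF continuous_integrable_on[OF exp_decaying_continuous[OF f]] L, of 0 N]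
    by (simp add: o_def)
  then show "((\<lambda>N. integral {0..N} (\<lambda>t. L (f t))) \<longlongrightarrow> L (half_line_integral f)) at_top"
    using bounded_linear.tendsto[OF L half_line_integral_tendsto[OF f c]] by simp
qed

lemma integral_has_vector_derivative_half_line:
  fixes f :: "real \<Rightarrow> 'x::banach"
  assumes f: "continuous_on {0..} f" and t: "t \<ge> 0"
  shows "((\<lambda>u. integral {0..u} f) has_vector_derivative f t) (at t within {0..})"
proof -
  have "((\<lambda>u. integral {0..u} f) has_vector_derivative f t) (at t within {0..t+1})"
    by (rule integral_has_vector_derivative[OF continuous_on_subset[OF f]]) (use t in auto)
  moreover have "at t within {0..t+1} = at t within {0..}"
    by (rule at_within_nhd[where S = "{..<t+1}"]) auto
  ultimately show ?thesis by (simp only:)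
qed

section \<open>Exponentially bounded semigroups and their Laplace integrals\<close>

locale exp_bounded_semigroup =
  fixes T :: "real \<Rightarrow> 'x::banach \<Rightarrow> 'x" and M \<omega> :: real
  assumes bounded_linear_T: "t \<ge> 0 \<Longrightarrow> bounded_linear (T t)"
    and T_add: "s \<ge> 0 \<Longrightarrow> t \<ge> 0 \<Longrightarrow> T (s + t) x = T s (T t x)"
    and T_0: "T 0 x = x"
    and continuous_T: "continuous_on {0..} (\<lambda>t. T t x)"
    and M_nonneg: "M \<ge> 0"
    and norm_T: "t \<ge> 0 \<Longrightarrow> norm (T t x) \<le> M * exp (\<omega> * t) * norm x"
begin

definition laplace :: "(real \<Rightarrow> real) \<Rightarrow> 'x \<Rightarrow> 'x" where
  "laplace k x = half_line_integral (\<lambda>t. k t *\<^sub>R T t x)"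

definition orbit_integral :: "real \<Rightarrow> 'x \<Rightarrow> 'x" where
  "orbit_integral r x = integral {0..r} (\<lambda>t. T t x)"

lemma T_commute: "s \<ge> 0 \<Longrightarrow> t \<ge> 0 \<Longrightarrow> T s (T t x) = T t (T s x)"
  by (metis T_add add.commute)

lemma exp_decaying_orbit:
  assumes k: "exp_decaying c k"
  shows "exp_decaying (c - \<omega>) (\<lambda>t. k t *\<^sub>R T t x)"
proof -
  obtain C where C: "C \<ge> 0" "\<And>t. t \<ge> 0 \<Longrightarrow> norm (k t) \<le> C * exp (- (c * t))"
    using k by (rule exp_decayingE) blast
  have "norm (k t *\<^sub>R T t x) \<le> (C * M * norm x) * exp (- ((c - \<omega>) * t))" if "t \<ge> 0" for t
  proof -
    have "norm (k t *\<^sub>R T t x) = norm (k t) * norm (T t x)" by simp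
    also have "\<dots> \<le> (C * exp (- (c * t))) * (M * exp (\<omega> * t) * norm x)"
      using C that norm_T by (intro mult_mono) auto
    also have "\<dots> = (C * M * norm x) * (exp (- (c * t)) * exp (\<omega> * t))"
      by simp
    also have "exp (- (c * t)) * exp (\<omega> * t) = exp (- ((c - \<omega>) * t))"
      by (simp add: exp_add[symmetric] algebra_simps)
    finally show ?thesis .
  qed
  moreover have "continuous_on {0..} (\<lambda>t. k t *\<^sub>R T t x)"
    by (intro continuous_intros exp_decaying_continuous[OF k] continuous_T)
  ultimately show ?thesis unfolding exp_decaying_def by blast
qed

lemma laplace_add_kernel:
  assumes "exp_decaying c k" "exp_decaying c l" "c > \<omega>"
  shows "laplace (\<lambda>t. k t + l t) x = laplace k x + laplace l x"
  unfolding laplace_def scaleR_add_left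
  by (rule half_line_integral_add[of "c - \<omega>"]) (use assms in \<open>auto intro: exp_decaying_orbit\<close>)

lemma laplace_scale_kernel:
  assumes k: "exp_decaying c k" and c: "c > \<omega>"
  shows "laplace (\<lambda>t. r * k t) x = r *\<^sub>R laplace k x"
  using half_line_integral_bounded_linear[OF bounded_linear_scaleR_right exp_decaying_orbit[OF k], of r x] c
  by (simp add: laplace_def)

lemma laplace_commute:
  assumes k: "exp_decaying c k" and c: "c > \<omega>"
    and L: "bounded_linear L" and LT: "\<And>t x. t \<ge> 0 \<Longrightarrow> L (T t x) = T t (L x)"
  shows "laplace k (L x) = L (laplace k x)"
proof -
  interpret L: bounded_linear L by fact
  have "laplace k (L x) = half_line_integral (\<lambda>t. L (k t *\<^sub>R T t x))"
    unfolding laplace_def by (rule half_line_integral_cong) (simp add: LT L.scaleR)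
  also have "\<dots> = L (laplace k x)"
    unfolding laplace_def
    by (rule half_line_integral_bounded_linear[OF L exp_decaying_orbit[OF k]]) (use c in simp)
  finally show ?thesis .
qed

lemma norm_laplace_le:
  assumes k: "exp_decaying c k" and c: "c > \<omega>"
    and g: "continuous_on {0..} g" "\<And>t. t \<ge> 0 \<Longrightarrow> \<bar>k t\<bar> * exp (\<omega> * t) \<le> g t"
    and B: "\<And>N. N \<ge> 0 \<Longrightarrow> integral {0..N} g \<le> B"
  shows "norm (laplace k x) \<le> M * B * norm x"
  unfolding laplace_def
proof (rule norm_half_line_integral_le[OF exp_decaying_orbit[OF k]])
  show "continuous_on {0..} (\<lambda>t. M * norm x * g t)"
    by (intro continuous_intros g)
  show "norm (k t *\<^sub>R T t x) \<le> M * norm x * g t" if "t \<ge> 0" for t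
  proof -
    have "norm (k t *\<^sub>R T t x) \<le> \<bar>k t\<bar> * (M * exp (\<omega> * t) * norm x)"
      using norm_T[OF that] by (simp add: mult_left_mono)
    also have "\<dots> = M * norm x * (\<bar>k t\<bar> * exp (\<omega> * t))" by simp
    also have "\<dots> \<le> M * norm x * g t"
      using M_nonneg g(2)[OF that] by (intro mult_left_mono) auto
    finally show ?thesis .
  qed
  show "integral {0..N} (\<lambda>t. M * norm x * g t) \<le> M * B * norm x" if "N \<ge> 0" for N
    using mult_left_mono[OF B[OF that], of "M * norm x"] M_nonneg by (simp add: mult_ac)
qed (use c in simp)

lemma bounded_linear_laplace:
  assumes k: "exp_decaying c k" and c: "c > \<omega>"
  shows "bounded_linear (laplace k)"
proof -
  obtain C where C: "C \<ge> 0" "\<And>t. t \<ge> 0 \<Longrightarrow> norm (k t) \<le> C * exp (- (c * t))"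
    using k by (rule exp_decayingE) blast
  define B where "B = C / (c - \<omega>)"
  have "norm (laplace k x) \<le> M * B * norm x" for x
  proof (rule norm_laplace_le[OF k c])
    show "continuous_on {0..} (\<lambda>t. C * exp (- ((c - \<omega>) * t)))"
      by (intro continuous_intros)
    show "\<bar>k t\<bar> * exp (\<omega> * t) \<le> C * exp (- ((c - \<omega>) * t))" if "t \<ge> 0" for t
    proof -
      have "\<bar>k t\<bar> * exp (\<omega> * t) \<le> C * exp (- (c * t)) * exp (\<omega> * t)"
        using C(2)[OF that] by (intro mult_right_mono) auto
      also have "\<dots> = C * exp (- ((c - \<omega>) * t))"
        by (simp add: mult.assoc exp_add[symmetric] algebra_simps)
      finally show ?thesis .
    qed
    show "integral {0..N} (\<lambda>t. C * exp (- ((c - \<omega>) * t))) \<le> B" if "N \<ge> 0" for N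
      using integral_unique[OF has_integral_exp_decay[of "c - \<omega>" 0 N C]] c that C(1)
      by (simp add: B_def divide_right_mono mult_left_le)
  qed
  moreover have "laplace k (x + y) = laplace k x + laplace k y" for x y
  proof -
    have "laplace k (x + y) = half_line_integral (\<lambda>t. k t *\<^sub>R T t x + k t *\<^sub>R T t y)"
      unfolding laplace_def
      by (rule half_line_integral_cong)
        (simp add: linear_simps(1)[OF bounded_linear_T] scaleR_add_right)
    also have "\<dots> = laplace k x + laplace k y"
      unfolding laplace_def
      by (rule half_line_integral_add[OF exp_decaying_orbit[OF k] exp_decaying_orbit[OF k]])
        (use c in simp)
    finally show ?thesis .
  qed
  moreover have "laplace k (r *\<^sub>R x) = r *\<^sub>R laplace k x" for r x
    by (rule laplace_commute[OF k c bounded_linear_scaleR_right])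
      (simp add: linear_simps(5)[OF bounded_linear_T])
  ultimately show ?thesis
    by (intro bounded_linear_intro[where K = "M * B"]) (auto simp: mult_ac)
qed

lemma orbit_integral_add:
  assumes "a \<ge> 0" "b \<ge> 0"
  shows "orbit_integral (a + b) x = orbit_integral a x + T a (orbit_integral b x)"
proof -
  have "orbit_integral (a + b) x = orbit_integral a x + integral {a..a + b} (\<lambda>t. T t x)"
    unfolding orbit_integral_def using assms
    by (intro Henstock_Kurzweil_Integration.integral_combine[symmetric]
        continuous_integrable_on continuous_T) auto
  also have "integral {a..a + b} (\<lambda>t. T t x) = integral {0..b} (\<lambda>t. T (t + a) x)"
    using integral_shift_real_ivl[of a a "a + b" "\<lambda>t. T t x"] by simp
  also have "\<dots> = integral {0..b} (\<lambda>t. T a (T t x))"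
    using assms by (intro integral_cong) (auto simp: T_add[symmetric] add.commute)
  also have "\<dots> = T a (orbit_integral b x)"
    using integral_linear[OF continuous_integrable_on[OF continuous_T] bounded_linear_T, of 0 a b x] assms
    by (simp add: o_def orbit_integral_def)
  finally show ?thesis .
qed

text \<open>
  Both sides are the integral of the orbit over \<open>[t, t + r]\<close>, computed once by the semigroup law
  and once by additivity of the integral.
\<close>

lemma orbit_integral_T:
  assumes "r \<ge> 0" "t \<ge> 0"
  shows "orbit_integral r (T t x) = orbit_integral r x + T r (orbit_integral t x) - orbit_integral t x"
proof -
  have "orbit_integral r (T t x) = integral {0..r} (\<lambda>s. T t (T s x))"
    unfolding orbit_integral_def using assms by (intro integral_cong) (auto simp: T_commute)
  also have "\<dots> = T t (orbit_integral r x)"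
    using integral_linear[OF continuous_integrable_on[OF continuous_T] bounded_linear_T, of 0 t r x] assms
    by (simp add: o_def orbit_integral_def)
  also have "\<dots> = orbit_integral (t + r) x - orbit_integral t x"
    using assms by (simp add: orbit_integral_add)
  also have "\<dots> = orbit_integral (r + t) x - orbit_integral t x"
    by (simp add: add.commute)
  also have "\<dots> = orbit_integral r x + T r (orbit_integral t x) - orbit_integral t x"
    using assms by (simp add: orbit_integral_add)
  finally show ?thesis .
qed

lemma bounded_linear_orbit_integral:
  assumes r: "r \<ge> 0"
  shows "bounded_linear (orbit_integral r)"
proof (rule bounded_linear_intro[where K = "M * exp (\<bar>\<omega>\<bar> * r) * r"])
  note int = continuous_integrable_on[OF continuous_T order_refl]
  show "orbit_integral r (x + y) = orbit_integral r x + orbit_integral r y" for x y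
  proof -
    have "orbit_integral r (x + y) = integral {0..r} (\<lambda>t. T t x + T t y)"
      unfolding orbit_integral_def
      by (intro integral_cong) (auto simp: linear_simps(1)[OF bounded_linear_T])
    also have "\<dots> = orbit_integral r x + orbit_integral r y"
      unfolding orbit_integral_def by (rule integral_add[OF int int])
    finally show ?thesis .
  qed
  show "orbit_integral r (a *\<^sub>R x) = a *\<^sub>R orbit_integral r x" for a x
  proof -
    have "orbit_integral r (a *\<^sub>R x) = integral {0..r} (\<lambda>t. a *\<^sub>R T t x)"
      unfolding orbit_integral_def
      by (intro integral_cong) (auto simp: linear_simps(5)[OF bounded_linear_T])
    then show ?thesis by (simp add: orbit_integral_def)
  qed
  show "norm (orbit_integral r x) \<le> norm x * (M * exp (\<bar>\<omega>\<bar> * r) * r)" for x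
  proof -
    have "norm (orbit_integral r x) \<le> (M * exp (\<bar>\<omega>\<bar> * r) * norm x) * (r - 0)"
      unfolding orbit_integral_def
    proof (rule integral_bound[OF r])
      show "continuous_on {0..r} (\<lambda>t. T t x)"
        by (rule continuous_on_subset[OF continuous_T]) auto
      fix t assume t: "t \<in> {0..r}"
      have "\<omega> * t \<le> \<bar>\<omega>\<bar> * r"
        using t by (intro mult_mono) auto
      then have "M * exp (\<omega> * t) * norm x \<le> M * exp (\<bar>\<omega>\<bar> * r) * norm x"
        using M_nonneg by (intro mult_right_mono mult_left_mono) auto
      with norm_T[of t x] t show "norm (T t x) \<le> M * exp (\<bar>\<omega>\<bar> * r) * norm x"
        by force
    qed
    then show ?thesis by (simp add: mult_ac)
  qed
qed

lemma orbit_integral_average: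
  "((\<lambda>r. (1 / r) *\<^sub>R orbit_integral r x) \<longlongrightarrow> x) (at_right 0)"
proof -
  have "((\<lambda>u. integral {0..u} (\<lambda>t. T t x)) has_vector_derivative T 0 x) (at 0 within {0..})"
    by (rule integral_has_vector_derivative_half_line[OF continuous_T]) simp
  then have "((\<lambda>u. integral {0..u} (\<lambda>t. T t x)) has_derivative (\<lambda>h. h *\<^sub>R x)) (at 0 within {0<..})"
    unfolding has_vector_derivative_def T_0 by (rule has_derivative_subset) auto
  then have "((\<lambda>u. norm (orbit_integral u x - u *\<^sub>R x) / \<bar>u\<bar>) \<longlongrightarrow> 0) (at_right 0)"
    by (simp add: has_derivative_iff_norm orbit_integral_def)
  then have "((\<lambda>u. norm ((1 / u) *\<^sub>R orbit_integral u x - x)) \<longlongrightarrow> 0) (at_right 0)"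
  proof (rule Lim_transform_eventually)
    show "\<forall>\<^sub>F u in at_right 0. norm (orbit_integral u x - u *\<^sub>R x) / \<bar>u\<bar> = norm ((1 / u) *\<^sub>R orbit_integral u x - x)"
    proof (rule eventually_at_rightI[of 0 1])
      fix u :: real assume "u \<in> {0<..<1}"
      then have "(1 / u) *\<^sub>R orbit_integral u x - x = (1 / u) *\<^sub>R (orbit_integral u x - u *\<^sub>R x)"
        by (simp add: scaleR_diff_right)
      then show "norm (orbit_integral u x - u *\<^sub>R x) / \<bar>u\<bar> = norm ((1 / u) *\<^sub>R orbit_integral u x - x)"
        by simp
    qed simp
  qed
  then show ?thesis
    by (simp only: tendsto_norm_zero_iff Lim_null[of _ x])
qed

text \<open>
  As functions of \<open>N\<close>, the two sides agree at \<open>0\<close>, and their difference \<open>\<Phi>\<close> has derivative zero: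
  the only term that is not differentiated at sight, \<open>k N\<close> times the orbit integral of \<open>T N x\<close>, is
  first rewritten by \<open>orbit_integral_T\<close>, after which \<open>N\<close> occurs in integration limits only and
  the fundamental theorem of calculus applies.
\<close>

lemma truncated_laplace_identity:
  fixes x :: 'x
  assumes k: "\<And>t. t \<ge> 0 \<Longrightarrow> (k has_vector_derivative k' t) (at t within {0..})"
    and k': "continuous_on {0..} k'" and r: "r \<ge> 0" and N: "N \<ge> 0"
  defines "J \<equiv> \<lambda>N. integral {0..N} (\<lambda>t. k t *\<^sub>R T t x)"
    and "J' \<equiv> \<lambda>N. integral {0..N} (\<lambda>t. k' t *\<^sub>R T t x)"
  shows "T r (J N) - J N = orbit_integral r (k N *\<^sub>R T N x - k 0 *\<^sub>R x - J' N)"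
proof -
  interpret Tr: bounded_linear "T r" by (rule bounded_linear_T[OF r])
  interpret Kr: bounded_linear "orbit_integral r" by (rule bounded_linear_orbit_integral[OF r])
  define K where "K t = orbit_integral t x" for t
  have cont_k: "continuous_on {0..} k"
    using k by (auto simp: continuous_on_eq_continuous_within intro: has_vector_derivative_continuous)
  define \<Phi> where "\<Phi> t = T r (J t) - J t
      - (k t *\<^sub>R (K r + T r (K t) - K t) - k 0 *\<^sub>R K r - orbit_integral r (J' t))" for t
  have d\<Phi>: "(\<Phi> has_vector_derivative 0) (at t within {0..N})" if t: "t \<in> {0..N}" for t
  proof -
    have t0: "t \<ge> 0" using t by simp
    have dJ: "(J has_vector_derivative k t *\<^sub>R T t x) (at t within {0..})"
      unfolding J_def
      by (rule integral_has_vector_derivative_half_line[OF _ t0]) (intro continuous_intros cont_k continuous_T)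
    have dJ': "(J' has_vector_derivative k' t *\<^sub>R T t x) (at t within {0..})"
      unfolding J'_def
      by (rule integral_has_vector_derivative_half_line[OF _ t0]) (intro continuous_intros k' continuous_T)
    have dK: "(K has_vector_derivative T t x) (at t within {0..})"
      unfolding K_def orbit_integral_def
      by (rule integral_has_vector_derivative_half_line[OF continuous_T t0])
    have "(\<Phi> has_vector_derivative (T r (k t *\<^sub>R T t x) - k t *\<^sub>R T t x
        - ((k t *\<^sub>R (0 + T r (T t x) - T t x) + k' t *\<^sub>R (K r + T r (K t) - K t)) - 0
            - orbit_integral r (k' t *\<^sub>R T t x)))) (at t within {0..})"
      unfolding \<Phi>_def
      by (intro has_vector_derivative_diff has_vector_derivative_add has_vector_derivative_const
          Tr.has_vector_derivative Kr.has_vector_derivative dJ dJ' dK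
          has_vector_derivative_scaleR k[OF t0, folded has_real_derivative_iff_has_vector_derivative])
    also have "T r (k t *\<^sub>R T t x) - k t *\<^sub>R T t x
        - ((k t *\<^sub>R (0 + T r (T t x) - T t x) + k' t *\<^sub>R (K r + T r (K t) - K t)) - 0
            - orbit_integral r (k' t *\<^sub>R T t x)) = 0"
      by (simp add: Tr.scaleR Kr.scaleR K_def orbit_integral_T[OF r t0] scaleR_diff_right)
    finally show ?thesis
      by (rule has_vector_derivative_within_subset) auto
  qed
  have "((\<lambda>_. 0) has_integral (\<Phi> N - \<Phi> 0)) {0..N}"
    using N d\<Phi> by (rule fundamental_theorem_of_calculus)
  then have "\<Phi> N = \<Phi> 0"
    using has_integral_unique[OF has_integral_0] by (metis eq_iff_diff_eq_0)
  also have "\<Phi> 0 = 0"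
    by (simp add: \<Phi>_def J_def J'_def K_def orbit_integral_def Tr.zero Kr.zero[unfolded orbit_integral_def])
  finally have "T r (J N) - J N = k N *\<^sub>R orbit_integral r (T N x) - k 0 *\<^sub>R K r - orbit_integral r (J' N)"
    using orbit_integral_T[OF r N, of x] by (simp add: \<Phi>_def K_def)
  then show ?thesis
    by (simp add: Kr.diff Kr.scaleR K_def)
qed

text \<open>
  The integrated form \<open>T r y - y = \<integral>\<^sub>0\<^sup>r T s z ds\<close> of \<open>A y = z\<close> involves bounded operators only, so
  it survives the limit \<open>N \<longlonglongrightarrow> \<infinity>\<close> in the truncated identity; the boundary term at \<open>N\<close> dies because
  \<open>c > \<omega>\<close>.
\<close>

lemma laplace_identity:
  assumes k: "\<And>t. t \<ge> 0 \<Longrightarrow> (k has_vector_derivative k' t) (at t within {0..})"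
    and dk: "exp_decaying c k" and dk': "exp_decaying c k'" and c: "c > \<omega>" and r: "r \<ge> 0"
  shows "T r (laplace k x) - laplace k x = orbit_integral r (- k 0 *\<^sub>R x - laplace k' x)"
proof (rule tendsto_unique[OF trivial_limit_at_top_linorder])
  let ?J = "\<lambda>N. integral {0..N} (\<lambda>t. k t *\<^sub>R T t x)"
  let ?J' = "\<lambda>N. integral {0..N} (\<lambda>t. k' t *\<^sub>R T t x)"
  have J: "(?J \<longlongrightarrow> laplace k x) at_top" and J': "(?J' \<longlongrightarrow> laplace k' x) at_top"
    unfolding laplace_def
    by (rule half_line_integral_tendsto[OF exp_decaying_orbit], fact, use c in simp)+
  show "((\<lambda>N. T r (?J N) - ?J N) \<longlongrightarrow> T r (laplace k x) - laplace k x) at_top"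
    by (intro tendsto_diff J bounded_linear.tendsto[OF bounded_linear_T[OF r]])
  obtain C where C: "\<And>t. t \<ge> 0 \<Longrightarrow> norm (k t *\<^sub>R T t x) \<le> C * exp (- ((c - \<omega>) * t))"
    using exp_decaying_orbit[OF dk] by (rule exp_decayingE) blast
  have "((\<lambda>N. C * exp (- ((c - \<omega>) * N))) \<longlongrightarrow> 0) at_top"
    using c by real_asymp
  then have "((\<lambda>N. k N *\<^sub>R T N x) \<longlongrightarrow> 0) at_top"
    by (rule Lim_null_comparison[rotated]) (use C in \<open>rule eventually_at_top_linorderI[of 0]\<close>)
  then have "((\<lambda>N. orbit_integral r (k N *\<^sub>R T N x - k 0 *\<^sub>R x - ?J' N)) \<longlongrightarrow>
      orbit_integral r (0 - k 0 *\<^sub>R x - laplace k' x)) at_top"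
    by (intro bounded_linear.tendsto[OF bounded_linear_orbit_integral[OF r]] tendsto_intros J')
  moreover have "\<forall>\<^sub>F N in at_top. orbit_integral r (k N *\<^sub>R T N x - k 0 *\<^sub>R x - ?J' N) = T r (?J N) - ?J N"
    by (rule eventually_at_top_linorderI[of 0])
      (rule truncated_laplace_identity[OF k exp_decaying_continuous[OF dk'] r, symmetric])
  ultimately have "((\<lambda>N. T r (?J N) - ?J N) \<longlongrightarrow>
      orbit_integral r (0 - k 0 *\<^sub>R x - laplace k' x)) at_top"
    by (rule Lim_transform_eventually)
  then show "((\<lambda>N. T r (?J N) - ?J N) \<longlongrightarrow> orbit_integral r (- k 0 *\<^sub>R x - laplace k' x)) at_top"
    by simp
qed

end

locale semigroup_generator = exp_bounded_semigroup T M \<omega>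
  for T :: "real \<Rightarrow> 'x::banach \<Rightarrow> 'x" and M \<omega> :: real +
  fixes D :: "'x set" and A :: "'x \<Rightarrow> 'x"
  assumes generator: "is_generator T D A"
begin

lemma generatorI:
  assumes "((\<lambda>h. (1 / h) *\<^sub>R (T h x - x)) \<longlongrightarrow> y) (at_right 0)"
  shows "x \<in> D" "A x = y"
proof -
  show "x \<in> D" using generator assms by (auto simp: is_generator_def)
  then have "((\<lambda>h. (1 / h) *\<^sub>R (T h x - x)) \<longlongrightarrow> A x) (at_right 0)"
    using generator by (auto simp: is_generator_def)
  then show "A x = y" using assms by (rule tendsto_unique[OF trivial_limit_at_right_real])
qed

lemma generatorD: "x \<in> D \<Longrightarrow> ((\<lambda>h. (1 / h) *\<^sub>R (T h x - x)) \<longlongrightarrow> A x) (at_right 0)"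
  using generator by (auto simp: is_generator_def)

text \<open>
  Integration by parts for the semigroup: the generator acts on a Laplace integral by
  differentiating the kernel. The integrated identity is divided by \<open>r\<close> and \<open>r\<close> is sent to \<open>0\<close>.
\<close>

lemma generator_laplace:
  assumes k: "\<And>t. t \<ge> 0 \<Longrightarrow> (k has_vector_derivative k' t) (at t within {0..})"
    and dk: "exp_decaying c k" and dk': "exp_decaying c k'" and c: "c > \<omega>"
  shows "laplace k x \<in> D" "A (laplace k x) = - k 0 *\<^sub>R x - laplace k' x"
proof -
  have "((\<lambda>h. (1 / h) *\<^sub>R (T h (laplace k x) - laplace k x)) \<longlongrightarrow> - k 0 *\<^sub>R x - laplace k' x) (at_right 0)"
    by (rule Lim_transform_eventually[OF orbit_integral_average])
      (auto simp: laplace_identity[OF k dk dk' c] eventually_at_right_less intro!: eventually_at_rightI[of 0 1])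
  then show "laplace k x \<in> D" "A (laplace k x) = - k 0 *\<^sub>R x - laplace k' x"
    by (rule generatorI)+
qed

text \<open>
  A Laplace integral commutes with every \<open>T h\<close> and is bounded, hence it commutes with the limit of
  the difference quotients.
\<close>

lemma generator_laplace_commute:
  assumes k: "exp_decaying c k" and c: "c > \<omega>" and x: "x \<in> D"
  shows "laplace k x \<in> D" "A (laplace k x) = laplace k (A x)"
proof -
  interpret L: bounded_linear "laplace k" by (rule bounded_linear_laplace[OF k c])
  have "((\<lambda>h. laplace k ((1 / h) *\<^sub>R (T h x - x))) \<longlongrightarrow> laplace k (A x)) (at_right 0)"
    by (rule L.tendsto[OF generatorD[OF x]])
  then have "((\<lambda>h. (1 / h) *\<^sub>R (T h (laplace k x) - laplace k x)) \<longlongrightarrow> laplace k (A x)) (at_right 0)"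
  proof (rule Lim_transform_eventually)
    show "\<forall>\<^sub>F h in at_right 0. laplace k ((1 / h) *\<^sub>R (T h x - x)) = (1 / h) *\<^sub>R (T h (laplace k x) - laplace k x)"
    proof (rule eventually_at_rightI[of 0 1])
      fix h :: real assume "h \<in> {0<..<1}"
      then have "laplace k (T h x) = T h (laplace k x)"
        by (intro laplace_commute[OF k c] bounded_linear_T T_commute) auto
      then show "laplace k ((1 / h) *\<^sub>R (T h x - x)) = (1 / h) *\<^sub>R (T h (laplace k x) - laplace k x)"
        by (simp only: L.scaleR L.diff)
    qed simp
  qed
  then show "laplace k x \<in> D" "A (laplace k x) = laplace k (A x)"
    by (rule generatorI)+
qed

text \<open>
  Two integrations by parts turn a second order linear differential equation for the kernel into
  a quadratic equation for the generator: \<open>A\<close> acts as \<open>- d/dt\<close> on kernels, up to boundary terms, so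
  that \<open>A\<^sup>2 - 2 a A + d\<close> acts as \<open>p'' + 2 a p' + d p\<close>.
\<close>

lemma quadratic_laplace:
  assumes p: "\<And>t. t \<ge> 0 \<Longrightarrow> (p has_vector_derivative p' t) (at t within {0..})"
    and p': "\<And>t. t \<ge> 0 \<Longrightarrow> (p' has_vector_derivative p'' t) (at t within {0..})"
    and dp: "exp_decaying c p" and dp': "exp_decaying c p'" and dp'': "exp_decaying c p''"
    and c: "c > \<omega>" and p0: "p 0 = 0"
    and ode: "\<And>t. t \<ge> 0 \<Longrightarrow> p'' t + 2 * a * p' t + d * p t = g t"
  shows "laplace p x \<in> square_domain D A"
    "A (A (laplace p x)) - (2 * a) *\<^sub>R A (laplace p x) + d *\<^sub>R laplace p x = p' 0 *\<^sub>R x + laplace g x"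
proof -
  note scale = exp_decaying_scale
  have dm: "((\<lambda>t. (-1) * p' t) has_vector_derivative (-1) * p'' t) (at t within {0..})" if "t \<ge> 0" for t
    using has_vector_derivative_mult_right[OF p'[OF that]] .
  have A1: "laplace p x \<in> D" "A (laplace p x) = - laplace p' x"
    using generator_laplace[OF p dp dp' c, of x] p0 by simp_all
  have m: "- laplace p' x = laplace (\<lambda>t. (-1) * p' t) x"
    using laplace_scale_kernel[OF dp' c, of "-1" x] by simp
  have m2: "laplace (\<lambda>t. (-1) * p'' t) x = - laplace p'' x"
    using laplace_scale_kernel[OF dp'' c, of "-1" x] by simp
  have A2: "- laplace p' x \<in> D" "A (- laplace p' x) = p' 0 *\<^sub>R x + laplace p'' x"
    unfolding m using generator_laplace[OF dm scale[OF dp'] scale[OF dp''] c, of x]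
    by (simp_all only: m2) simp
  show "laplace p x \<in> square_domain D A"
    using A1 A2 by (simp add: square_domain_def)
  have "laplace g x = laplace (\<lambda>t. (p'' t + (2 * a) * p' t) + d * p t) x"
    unfolding laplace_def using ode by (intro half_line_integral_cong) (simp add: mult_ac)
  also have "\<dots> = laplace p'' x + (2 * a) *\<^sub>R laplace p' x + d *\<^sub>R laplace p x"
    using laplace_add_kernel[OF exp_decaying_add[OF dp'' scale[OF dp', of "2 * a"]] scale[OF dp, of d] c]
      laplace_add_kernel[OF dp'' scale[OF dp', of "2 * a"] c]
      laplace_scale_kernel[OF dp' c, of "2 * a"] laplace_scale_kernel[OF dp c, of d]
    by simp
  finally show "A (A (laplace p x)) - (2 * a) *\<^sub>R A (laplace p x) + d *\<^sub>R laplace p x = p' 0 *\<^sub>R x + laplace g x"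
    using A1 A2 by simp
qed

end

section \<open>The damped oscillator and its convolution powers\<close>

definition sine_quotient :: "real \<Rightarrow> real \<Rightarrow> real" where
  "sine_quotient b t = (if b = 0 then t else sin (b * t) / b)"

definition damped_sine :: "real \<Rightarrow> real \<Rightarrow> real \<Rightarrow> real" where
  "damped_sine a b t = exp (- (a * t)) * sine_quotient b t"

definition damped_cosine :: "real \<Rightarrow> real \<Rightarrow> real \<Rightarrow> real" where
  "damped_cosine a b t = exp (- (a * t)) * cos (b * t)"

lemma DERIV_sine_quotient: "(sine_quotient b has_real_derivative cos (b * t)) (at t within S)"
proof (cases "b = 0")
  case True
  then have "sine_quotient b = (\<lambda>t. t)" by (auto simp: sine_quotient_def)
  then show ?thesis using True by simp
next
  case False
  then have "sine_quotient b = (\<lambda>t. sin (b * t) / b)" by (auto simp: sine_quotient_def)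
  then show ?thesis using False by (auto intro!: derivative_eq_intros)
qed

lemma sine_quotient_mult: "b * sine_quotient b t = sin (b * t)"
  by (simp add: sine_quotient_def)

lemma sine_quotient_0 [simp]: "sine_quotient b 0 = 0"
  by (simp add: sine_quotient_def)

lemma sine_quotient_diff:
  "sine_quotient b (t - s) = sine_quotient b t * cos (b * s) - cos (b * t) * sine_quotient b s"
  by (simp add: sine_quotient_def right_diff_distrib sin_diff diff_divide_distrib)

lemma abs_sine_quotient_le: "\<bar>sine_quotient b t\<bar> \<le> \<bar>t\<bar>"
proof (cases "b = 0")
  case False
  have "\<bar>sin (b * t)\<bar> \<le> \<bar>b * t\<bar>" by (rule abs_sin_x_le_abs_x)
  then show ?thesis using False by (simp add: sine_quotient_def abs_mult divide_simps mult.commute)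
qed (simp add: sine_quotient_def)

lemma damped_sine_diff:
  "damped_sine a b (t - s) =
     damped_sine a b t * (exp (a * s) * cos (b * s)) - damped_cosine a b t * (exp (a * s) * sine_quotient b s)"
proof -
  have "exp (- (a * (t - s))) = exp (- (a * t)) * exp (a * s)"
    by (simp add: exp_add[symmetric] algebra_simps)
  then show ?thesis
    by (simp add: damped_sine_def damped_cosine_def sine_quotient_diff algebra_simps)
qed

lemma damped_cosine_diff:
  "damped_cosine a b (t - s) =
     damped_cosine a b t * (exp (a * s) * cos (b * s)) + b\<^sup>2 * damped_sine a b t * (exp (a * s) * sine_quotient b s)"
proof -
  have "exp (- (a * (t - s))) = exp (- (a * t)) * exp (a * s)"
    by (simp add: exp_add[symmetric] algebra_simps)
  moreover have "cos (b * (t - s)) = cos (b * t) * cos (b * s) + (b * sine_quotient b t) * (b * sine_quotient b s)"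
    by (simp only: sine_quotient_mult right_diff_distrib cos_diff)
  ultimately show ?thesis
    by (simp add: damped_sine_def damped_cosine_def power2_eq_square algebra_simps)
qed

lemma DERIV_damped_sine:
  "(damped_sine a b has_real_derivative damped_cosine a b t - a * damped_sine a b t) (at t within S)"
  unfolding damped_sine_def[abs_def] damped_cosine_def
  by (auto intro!: derivative_eq_intros DERIV_sine_quotient)

lemma DERIV_damped_cosine:
  "(damped_cosine a b has_real_derivative - b\<^sup>2 * damped_sine a b t - a * damped_cosine a b t) (at t within S)"
  unfolding damped_sine_def damped_cosine_def[abs_def]
  by (auto intro!: derivative_eq_intros simp: power2_eq_square sine_quotient_mult algebra_simps)

lemma continuous_on_damped_sine: "continuous_on S (damped_sine a b)"
  by (rule DERIV_continuous_on[OF DERIV_damped_sine])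

lemma continuous_on_damped_cosine: "continuous_on S (damped_cosine a b)"
  by (rule DERIV_continuous_on[OF DERIV_damped_cosine])

text \<open>
  The solution \<open>p\<close> of \<open>p'' + 2 a p' + (a\<^sup>2 + b\<^sup>2) p = g\<close> with \<open>p 0 = p' 0 = 0\<close>, by Duhamel's
  formula. The velocity is \<open>p' + a p\<close>, which is \<open>exp (- a t)\<close> times the derivative of the undamped
  motion \<open>exp (a t) p(t)\<close>; with it the equation becomes a first order system (\<open>oscillator_derivatives\<close>).
\<close>

definition oscillator_response :: "real \<Rightarrow> real \<Rightarrow> (real \<Rightarrow> real) \<Rightarrow> real \<Rightarrow> real" where
  "oscillator_response a b g t = integral {0..t} (\<lambda>s. damped_sine a b (t - s) * g s)"

definition oscillator_velocity :: "real \<Rightarrow> real \<Rightarrow> (real \<Rightarrow> real) \<Rightarrow> real \<Rightarrow> real" where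
  "oscillator_velocity a b g t = integral {0..t} (\<lambda>s. damped_cosine a b (t - s) * g s)"

text \<open>
  By the addition theorems both convolutions are combinations of the integrals \<open>P\<close> and \<open>Q\<close>, whose
  coefficients do not depend on the integration variable, so the product rule suffices. The terms
  in which \<open>P\<close> and \<open>Q\<close> are differentiated combine to \<open>0\<close> and to \<open>g t\<close>.
\<close>

lemma oscillator_derivatives:
  assumes g: "continuous_on {0..} g" and t: "t \<ge> 0"
  shows "(oscillator_response a b g has_real_derivative
      oscillator_velocity a b g t - a * oscillator_response a b g t) (at t within {0..})" (is ?response)
    and "(oscillator_velocity a b g has_real_derivative
      g t - b\<^sup>2 * oscillator_response a b g t - a * oscillator_velocity a b g t) (at t within {0..})" (is ?velocity)
proof -
  define u where "u s = exp (a * s) * cos (b * s) * g s" for s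
  define v where "v s = exp (a * s) * sine_quotient b s * g s" for s
  define P where "P t = integral {0..t} u" for t
  define Q where "Q t = integral {0..t} v" for t
  have cont_sq: "continuous_on {0..} (sine_quotient b)"
    by (rule DERIV_continuous_on[OF DERIV_sine_quotient])
  have cont: "continuous_on {0..} u" "continuous_on {0..} v"
    unfolding u_def v_def by (intro continuous_intros g cont_sq)+
  note int = continuous_integrable_on[OF cont(1) order_refl] continuous_integrable_on[OF cont(2) order_refl]
  have dP: "(P has_real_derivative u t) (at t within {0..})" and dQ: "(Q has_real_derivative v t) (at t within {0..})"
    unfolding P_def Q_def has_real_derivative_iff_has_vector_derivative
    using cont t by (auto intro: integral_has_vector_derivative_half_line)
  have resp: "oscillator_response a b g = (\<lambda>t. damped_sine a b t * P t - damped_cosine a b t * Q t)"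
  proof
    fix t
    have "oscillator_response a b g t = integral {0..t} (\<lambda>s. damped_sine a b t * u s - damped_cosine a b t * v s)"
      unfolding oscillator_response_def u_def v_def damped_sine_diff
      by (intro integral_cong) (simp add: algebra_simps)
    also have "\<dots> = integral {0..t} (\<lambda>s. damped_sine a b t * u s) - integral {0..t} (\<lambda>s. damped_cosine a b t * v s)"
      by (intro Henstock_Kurzweil_Integration.integral_diff integrable_on_mult_right int)
    finally show "oscillator_response a b g t = damped_sine a b t * P t - damped_cosine a b t * Q t"
      by (simp add: P_def Q_def)
  qed
  have vel: "oscillator_velocity a b g = (\<lambda>t. damped_cosine a b t * P t + b\<^sup>2 * damped_sine a b t * Q t)"
  proof
    fix t
    have "oscillator_velocity a b g t = integral {0..t} (\<lambda>s. damped_cosine a b t * u s + b\<^sup>2 * damped_sine a b t * v s)"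
      unfolding oscillator_velocity_def u_def v_def damped_cosine_diff
      by (intro integral_cong) (simp add: algebra_simps)
    also have "\<dots> = integral {0..t} (\<lambda>s. damped_cosine a b t * u s) + integral {0..t} (\<lambda>s. b\<^sup>2 * damped_sine a b t * v s)"
      by (intro Henstock_Kurzweil_Integration.integral_add integrable_on_mult_right int)
    finally show "oscillator_velocity a b g t = damped_cosine a b t * P t + b\<^sup>2 * damped_sine a b t * Q t"
      by (simp add: P_def Q_def)
  qed
  have wronskian_sine: "damped_sine a b t * u t = damped_cosine a b t * v t"
    by (simp add: u_def v_def damped_sine_def damped_cosine_def)
  \<comment> \<open>The exponentials cancel and \<open>cos\<^sup>2 + sin\<^sup>2 = 1\<close> remains.\<close>
  have wronskian_cosine: "damped_cosine a b t * u t + b\<^sup>2 * damped_sine a b t * v t = g t"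
  proof -
    have "damped_cosine a b t * u t + b\<^sup>2 * damped_sine a b t * v t
        = (exp (- (a * t)) * exp (a * t)) * (cos (b * t) * cos (b * t)
          + (b * sine_quotient b t) * (b * sine_quotient b t)) * g t"
      by (simp add: u_def v_def damped_sine_def damped_cosine_def power2_eq_square algebra_simps)
    also have "\<dots> = g t"
      using sin_cos_squared_add3[of "b * t"]
      by (simp add: sine_quotient_mult exp_minus_inverse exp_add[symmetric])
    finally show ?thesis .
  qed
  show ?response
    unfolding resp vel
    by (rule derivative_eq_intros DERIV_damped_sine DERIV_damped_cosine dP dQ refl)+
      (use wronskian_sine in \<open>simp add: algebra_simps\<close>)
  show ?velocity
    unfolding resp vel
    by (rule derivative_eq_intros DERIV_damped_sine DERIV_damped_cosine dP dQ refl)+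
      (use wronskian_cosine in \<open>simp add: algebra_simps\<close>)
qed

lemma DERIV_power_fact:
  "((\<lambda>s::real. s ^ Suc m / fact (Suc m)) has_real_derivative s ^ m / fact m) (at s within X)"
proof -
  have "((\<lambda>s::real. s ^ Suc m / fact (Suc m)) has_real_derivative
      (real (Suc m) * s ^ m) / fact (Suc m)) (at s within X)"
    by (rule DERIV_cdivide) (use DERIV_power_Suc[OF DERIV_ident] in simp)
  then show ?thesis by (simp del: of_nat_Suc power_Suc)
qed

lemma integral_power_fact:
  assumes "t \<ge> 0"
  shows "((\<lambda>s. s ^ m / fact m) has_integral t ^ (m + 1) / fact (m + 1)) {0..t::real}"
    and "((\<lambda>s. (t - s) * (s ^ m / fact m)) has_integral t ^ (m + 2) / fact (m + 2)) {0..t::real}"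
proof -
  note d = DERIV_power_fact
  have "((\<lambda>s. s ^ m / fact m) has_integral t ^ Suc m / fact (Suc m) - 0 ^ Suc m / fact (Suc m)) {0..t}"
    using assms d[unfolded has_real_derivative_iff_has_vector_derivative]
    by (intro fundamental_theorem_of_calculus) auto
  then show "((\<lambda>s. s ^ m / fact m) has_integral t ^ (m + 1) / fact (m + 1)) {0..t::real}"
    by simp
  let ?F = "\<lambda>s. (t - s) * (s ^ Suc m / fact (Suc m)) + s ^ Suc (Suc m) / fact (Suc (Suc m))"
  have "(?F has_real_derivative (t - s) * (s ^ m / fact m)) (at s within {0..t})" for s
  proof -
    have "(?F has_real_derivative ((0 - 1) * (s ^ Suc m / fact (Suc m)) + (s ^ m / fact m) * (t - s))
        + s ^ Suc m / fact (Suc m)) (at s within {0..t})"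
      by (intro DERIV_add DERIV_mult DERIV_diff DERIV_const DERIV_ident d)
    then show ?thesis by (simp add: mult.commute)
  qed
  then have "((\<lambda>s. (t - s) * (s ^ m / fact m)) has_integral ?F t - ?F 0) {0..t}"
    using assms unfolding has_real_derivative_iff_has_vector_derivative
    by (intro fundamental_theorem_of_calculus) auto
  then show "((\<lambda>s. (t - s) * (s ^ m / fact m)) has_integral t ^ (m + 2) / fact (m + 2)) {0..t::real}"
    by simp
qed

text \<open>
  The sine quotient is bounded by its argument and the cosine by 1, so the two convolutions are
  dominated by a double and a single integration of \<open>s ^ m / fact m\<close>; the exponential factors
  multiply to \<open>exp (- (a * t))\<close>.
\<close>

lemma oscillator_bounds:
  assumes g: "continuous_on {0..} g" and t: "t \<ge> 0"
    and bound: "\<And>s. s \<ge> 0 \<Longrightarrow> \<bar>g s\<bar> \<le> exp (- (a * s)) * (s ^ m / fact m)"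
  shows "\<bar>oscillator_response a b g t\<bar> \<le> exp (- (a * t)) * (t ^ (m + 2) / fact (m + 2))"
    and "\<bar>oscillator_velocity a b g t\<bar> \<le> exp (- (a * t)) * (t ^ (m + 1) / fact (m + 1))"
proof -
  have ex: "exp (- (a * (t - s))) * exp (- (a * s)) = exp (- (a * t))" for s
    by (simp add: exp_add[symmetric] algebra_simps)
  have cg: "continuous_on {0..t} g"
    by (rule continuous_on_subset[OF g]) auto
  have "norm (oscillator_response a b g t) \<le> integral {0..t} (\<lambda>s. exp (- (a * t)) * ((t - s) * (s ^ m / fact m)))"
    unfolding oscillator_response_def
  proof (rule integral_norm_bound_integral)
    show "(\<lambda>s. damped_sine a b (t - s) * g s) integrable_on {0..t}"
      by (intro integrable_continuous_real continuous_intros cg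
          continuous_on_compose2[OF continuous_on_damped_sine[of UNIV]]) auto
    show "(\<lambda>s. exp (- (a * t)) * ((t - s) * (s ^ m / fact m))) integrable_on {0..t}"
      by (intro integrable_continuous_real continuous_intros) auto
    fix s assume s: "s \<in> {0..t}"
    have "\<bar>sine_quotient b (t - s)\<bar> \<le> t - s"
      using abs_sine_quotient_le[of b "t - s"] s by simp
    then have "norm (damped_sine a b (t - s) * g s)
        \<le> (exp (- (a * (t - s))) * (t - s)) * (exp (- (a * s)) * (s ^ m / fact m))"
      unfolding damped_sine_def norm_mult
      using s bound[of s] by (intro mult_mono) auto
    also have "\<dots> = (exp (- (a * (t - s))) * exp (- (a * s))) * ((t - s) * (s ^ m / fact m))"
      by (simp only: mult_ac)
    finally show "norm (damped_sine a b (t - s) * g s) \<le> exp (- (a * t)) * ((t - s) * (s ^ m / fact m))"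
      by (simp only: ex)
  qed
  also have "\<dots> = exp (- (a * t)) * (t ^ (m + 2) / fact (m + 2))"
    by (rule integral_unique[OF has_integral_mult_right[OF integral_power_fact(2)[OF t]]])
  finally show "\<bar>oscillator_response a b g t\<bar> \<le> exp (- (a * t)) * (t ^ (m + 2) / fact (m + 2))"
    by (simp only: real_norm_def)
  have "norm (oscillator_velocity a b g t) \<le> integral {0..t} (\<lambda>s. exp (- (a * t)) * (s ^ m / fact m))"
    unfolding oscillator_velocity_def
  proof (rule integral_norm_bound_integral)
    show "(\<lambda>s. damped_cosine a b (t - s) * g s) integrable_on {0..t}"
      by (intro integrable_continuous_real continuous_intros cg
          continuous_on_compose2[OF continuous_on_damped_cosine[of UNIV]]) auto
    show "(\<lambda>s. exp (- (a * t)) * (s ^ m / fact m)) integrable_on {0..t}"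
      by (intro integrable_continuous_real continuous_intros) auto
    fix s assume s: "s \<in> {0..t}"
    have "norm (damped_cosine a b (t - s) * g s)
        \<le> (exp (- (a * (t - s))) * 1) * (exp (- (a * s)) * (s ^ m / fact m))"
      unfolding damped_cosine_def norm_mult
      using s bound[of s] by (intro mult_mono) auto
    also have "\<dots> = (exp (- (a * (t - s))) * exp (- (a * s))) * (s ^ m / fact m)"
      by (simp only: mult_ac mult_1_right)
    finally show "norm (damped_cosine a b (t - s) * g s) \<le> exp (- (a * t)) * (s ^ m / fact m)"
      by (simp only: ex)
  qed
  also have "\<dots> = exp (- (a * t)) * (t ^ (m + 1) / fact (m + 1))"
    by (rule integral_unique[OF has_integral_mult_right[OF integral_power_fact(1)[OF t]]])
  finally show "\<bar>oscillator_velocity a b g t\<bar> \<le> exp (- (a * t)) * (t ^ (m + 1) / fact (m + 1))"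
    by (simp only: real_norm_def)
qed

lemma power_over_fact_le_exp:
  fixes x :: real
  assumes "x \<ge> 0"
  shows "x ^ m / fact m \<le> exp x"
proof -
  have "(\<Sum>n\<in>{m}. x ^ n /\<^sub>R fact n) \<le> (\<Sum>n. x ^ n /\<^sub>R fact n)"
    by (rule sum_le_suminf[OF summable_exp_generic]) (use assms in auto)
  then show ?thesis by (simp add: exp_def divide_inverse mult.commute)
qed

text \<open>
  Polynomial growth costs an arbitrarily small part of the exponential rate.
\<close>

lemma exp_decaying_power:
  fixes k :: "real \<Rightarrow> real"
  assumes "continuous_on {0..} k" and ac: "c < a"
    and bound: "\<And>t. t \<ge> 0 \<Longrightarrow> \<bar>k t\<bar> \<le> exp (- (a * t)) * (t ^ m / fact m)"
  shows "exp_decaying c k"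
  unfolding exp_decaying_def
proof (intro conjI exI allI impI)
  fix t :: real assume t: "t \<ge> 0"
  have "t ^ m / fact m = (1 / (a - c) ^ m) * (((a - c) * t) ^ m / fact m)"
    using ac by (simp add: power_mult_distrib)
  also have "\<dots> \<le> (1 / (a - c) ^ m) * exp ((a - c) * t)"
    using ac t by (intro mult_left_mono power_over_fact_le_exp) auto
  finally have "exp (- (a * t)) * (t ^ m / fact m) \<le> exp (- (a * t)) * ((1 / (a - c) ^ m) * exp ((a - c) * t))"
    by (rule mult_left_mono) simp
  also have "\<dots> = (1 / (a - c) ^ m) * (exp (- (a * t)) * exp ((a - c) * t))"
    by (simp only: mult_ac)
  also have "exp (- (a * t)) * exp ((a - c) * t) = exp (- (c * t))"
    by (simp add: exp_add[symmetric] algebra_simps)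
  finally show "norm (k t) \<le> (1 / (a - c) ^ m) * exp (- (c * t))"
    using bound[OF t] by simp
qed (fact assms)

text \<open>
  Integration by parts lowers the degree and contributes the factor \<open>1 / l\<close> and a boundary term
  that is not positive. The full integral over the half-line is the value of the Gamma integral.
\<close>

lemma integral_exp_power_le:
  fixes l :: real
  assumes l: "l > 0" and N: "N \<ge> 0"
  shows "integral {0..N} (\<lambda>t. exp (- (l * t)) * (t ^ m / fact m)) \<le> 1 / l ^ Suc m"
proof (induction m)
  case 0
  show ?case
    using integral_unique[OF has_integral_exp_decay[OF l N, of 1]] l by (simp add: divide_right_mono)
next
  case (Suc m)
  let ?g = "\<lambda>m t. exp (- (l * t)) * (t ^ m / fact m)"
  have int: "?g m integrable_on {0..N}" for m
    by (intro integrable_continuous_real continuous_intros) auto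
  let ?F = "\<lambda>t. - (exp (- (l * t)) * (t ^ Suc m / fact (Suc m))) / l"
  have "(?F has_real_derivative ?g (Suc m) t - ?g m t / l) (at t within {0..N})" for t
  proof -
    have "((\<lambda>t. exp (- (l * t))) has_real_derivative - l * exp (- (l * t))) (at t within {0..N})"
      by (auto intro!: derivative_eq_intros)
    from DERIV_cdivide[OF DERIV_minus[OF DERIV_mult[OF this DERIV_power_fact[of m t]]], of l] show ?thesis
      by (rule DERIV_cong) (use l in \<open>simp add: diff_divide_distrib add_divide_distrib mult.commute\<close>)
  qed
  then have "((\<lambda>t. ?g (Suc m) t - ?g m t / l) has_integral ?F N - ?F 0) {0..N}"
    using N unfolding has_real_derivative_iff_has_vector_derivative
    by (intro fundamental_theorem_of_calculus) auto
  then have "integral {0..N} (\<lambda>t. ?g (Suc m) t - ?g m t / l) = ?F N - ?F 0"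
    by (rule integral_unique)
  moreover have "integral {0..N} (\<lambda>t. ?g (Suc m) t - ?g m t / l)
      = integral {0..N} (?g (Suc m)) - integral {0..N} (?g m) / l"
    using Henstock_Kurzweil_Integration.integral_diff[OF int[of "Suc m"] integrable_on_divide[OF int[of m], of l]]
    by simp
  moreover have "?F N - ?F 0 \<le> 0"
    using l N by simp
  ultimately have "integral {0..N} (?g (Suc m)) \<le> integral {0..N} (?g m) / l"
    by linarith
  also have "\<dots> \<le> (1 / l ^ Suc m) / l"
    using Suc l by (intro divide_right_mono) auto
  finally show ?case by (simp add: mult.commute)
qed

text \<open>
  Convolution has no unit among functions, so index \<open>n\<close> stands for \<open>n + 1\<close> factors.
\<close>

primrec oscillator_kernel :: "real \<Rightarrow> real \<Rightarrow> nat \<Rightarrow> real \<Rightarrow> real" where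
  "oscillator_kernel a b 0 = damped_sine a b"
| "oscillator_kernel a b (Suc n) = oscillator_response a b (oscillator_kernel a b n)"

lemma oscillator_kernel_bound:
  "continuous_on {0..} (oscillator_kernel a b n) \<and>
    (\<forall>t\<ge>0. \<bar>oscillator_kernel a b n t\<bar> \<le> exp (- (a * t)) * (t ^ (2 * n + 1) / fact (2 * n + 1)))"
proof (induction n)
  case 0
  have "\<bar>damped_sine a b t\<bar> \<le> exp (- (a * t)) * t" if "t \<ge> 0" for t
    using abs_sine_quotient_le[of b t] that by (simp add: damped_sine_def abs_mult)
  then show ?case by (simp add: continuous_on_damped_sine)
next
  case (Suc n)
  then have g: "continuous_on {0..} (oscillator_kernel a b n)"
    and bound: "\<And>t. t \<ge> 0 \<Longrightarrow> \<bar>oscillator_kernel a b n t\<bar> \<le> exp (- (a * t)) * (t ^ (2 * n + 1) / fact (2 * n + 1))"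
    by auto
  have "continuous_on {0..} (oscillator_response a b (oscillator_kernel a b n))"
    by (rule DERIV_continuous_on[OF oscillator_derivatives(1)[OF g]]) simp
  moreover have "2 * n + 1 + 2 = 2 * Suc n + 1" by simp
  ultimately show ?case
    using oscillator_bounds(1)[OF g _ bound, of _ b] by (simp only: oscillator_kernel.simps) metis
qed

lemmas continuous_on_oscillator_kernel = oscillator_kernel_bound[THEN conjunct1]
lemmas abs_oscillator_kernel_le = oscillator_kernel_bound[THEN conjunct2, rule_format]

lemma exp_decaying_damped_cosine: "c < a \<Longrightarrow> exp_decaying c (damped_cosine a b)"
  by (rule exp_decaying_power[OF continuous_on_damped_cosine, where m = 0])
    (auto simp: damped_cosine_def abs_mult mult_left_le)

lemma exp_decaying_oscillator_kernel: "c < a \<Longrightarrow> exp_decaying c (oscillator_kernel a b n)"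
  by (rule exp_decaying_power[OF continuous_on_oscillator_kernel _ abs_oscillator_kernel_le])

section \<open>The quadratic resolvent\<close>

context semigroup_generator
begin

text \<open>
  The damped sine is the Green's function of the operator \<open>p'' + 2 a p' + (a\<^sup>2 + b\<^sup>2) p\<close>: it solves
  the homogeneous equation with initial velocity 1, whence the identity operator. Convolution with
  it solves the inhomogeneous equation with zero initial data, whence the recursion.
\<close>

lemma quadratic_laplace_oscillator:
  assumes a: "a > \<omega>"
  shows "laplace (oscillator_kernel a b 0) x \<in> square_domain D A"
    and "laplace (oscillator_kernel a b (Suc n)) x \<in> square_domain D A"
    and "(\<lambda>y. A (A y) - (2 * a) *\<^sub>R A y + (a\<^sup>2 + b\<^sup>2) *\<^sub>R y) (laplace (oscillator_kernel a b 0) x) = x"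
    and "(\<lambda>y. A (A y) - (2 * a) *\<^sub>R A y + (a\<^sup>2 + b\<^sup>2) *\<^sub>R y) (laplace (oscillator_kernel a b (Suc n)) x)
      = laplace (oscillator_kernel a b n) x"
proof -
  \<comment> \<open>A rate below the decay rate of the kernels and above the growth rate of the semigroup.\<close>
  define c where "c = (a + \<omega>) / 2"
  have c: "c > \<omega>" "c < a" using a by (auto simp: c_def)
  note dv = has_real_derivative_iff_has_vector_derivative
  show "laplace (oscillator_kernel a b 0) x \<in> square_domain D A"
    "(\<lambda>y. A (A y) - (2 * a) *\<^sub>R A y + (a\<^sup>2 + b\<^sup>2) *\<^sub>R y) (laplace (oscillator_kernel a b 0) x) = x"
  proof -
    define p where "p = damped_sine a b"
    define p' where "p' t = damped_cosine a b t + (- a) * p t" for t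
    define p'' where "p'' t = (- (2 * a)) * p' t + (- (a\<^sup>2 + b\<^sup>2)) * p t" for t
    have dp: "exp_decaying c p"
      using exp_decaying_oscillator_kernel[OF c(2), of b 0] by (simp add: p_def)
    have dp': "exp_decaying c p'"
      unfolding p'_def[abs_def] by (intro exp_decaying_add exp_decaying_scale exp_decaying_damped_cosine c dp)
    have dp'': "exp_decaying c p''"
      unfolding p''_def[abs_def] by (intro exp_decaying_add exp_decaying_scale dp dp')
    have p: "(p has_vector_derivative p' t) (at t within {0..})" for t
      using DERIV_damped_sine[of a b t] by (simp add: dv p_def p'_def)
    have "(p' has_real_derivative p'' t) (at t within {0..})" for t
      unfolding p'_def[abs_def] p''_def unfolding p_def
      by (rule derivative_eq_intros DERIV_damped_sine DERIV_damped_cosine refl)+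
        (simp add: power2_eq_square algebra_simps)
    then have p': "(p' has_vector_derivative p'' t) (at t within {0..})" for t
      by (simp add: dv)
    have ode: "p'' t + 2 * a * p' t + (a\<^sup>2 + b\<^sup>2) * p t = 0" for t
      by (simp add: p''_def algebra_simps)
    have init: "p 0 = 0" "p' 0 = 1"
      by (simp_all add: p_def p'_def damped_sine_def damped_cosine_def)
    have zero: "laplace (\<lambda>_. 0) x = 0"
      unfolding laplace_def by (rule half_line_integral_eqI) simp
    show "laplace (oscillator_kernel a b 0) x \<in> square_domain D A"
      "(\<lambda>y. A (A y) - (2 * a) *\<^sub>R A y + (a\<^sup>2 + b\<^sup>2) *\<^sub>R y) (laplace (oscillator_kernel a b 0) x) = x"
      using quadratic_laplace[OF p p' dp dp' dp'' c(1) init(1) ode, of x] init zero by (simp_all add: p_def)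
  qed
  show "laplace (oscillator_kernel a b (Suc n)) x \<in> square_domain D A"
    "(\<lambda>y. A (A y) - (2 * a) *\<^sub>R A y + (a\<^sup>2 + b\<^sup>2) *\<^sub>R y) (laplace (oscillator_kernel a b (Suc n)) x)
      = laplace (oscillator_kernel a b n) x"
  proof -
    define g where "g = oscillator_kernel a b n"
    have g: "continuous_on {0..} g"
      by (simp add: g_def continuous_on_oscillator_kernel)
    define p where "p = oscillator_response a b g"
    define w where "w = oscillator_velocity a b g"
    define p' where "p' t = w t + (- a) * p t" for t
    define p'' where "p'' t = g t + ((- (2 * a)) * p' t + (- (a\<^sup>2 + b\<^sup>2)) * p t)" for t
    have w: "exp_decaying c w"
      unfolding w_def
    proof (rule exp_decaying_power[OF _ c(2)])
      show "continuous_on {0..} (oscillator_velocity a b g)"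
        by (rule DERIV_continuous_on[OF oscillator_derivatives(2)[OF g]]) simp
      show "\<bar>oscillator_velocity a b g t\<bar> \<le> exp (- (a * t)) * (t ^ (2 * n + 1 + 1) / fact (2 * n + 1 + 1))"
        if "t \<ge> 0" for t
        by (rule oscillator_bounds(2)[OF g that]) (simp only: g_def abs_oscillator_kernel_le)
    qed
    have dg: "exp_decaying c g"
      unfolding g_def by (rule exp_decaying_oscillator_kernel[OF c(2)])
    have dp: "exp_decaying c p"
      using exp_decaying_oscillator_kernel[OF c(2), of b "Suc n"] by (simp add: p_def g_def)
    have dp': "exp_decaying c p'"
      unfolding p'_def[abs_def] by (intro exp_decaying_add exp_decaying_scale w dp)
    have dp'': "exp_decaying c p''"
      unfolding p''_def[abs_def] by (intro exp_decaying_add exp_decaying_scale dg dp dp')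
    have p: "(p has_vector_derivative p' t) (at t within {0..})" if "t \<ge> 0" for t
      using oscillator_derivatives(1)[OF g that, of a b] by (simp add: dv p_def p'_def w_def)
    have "(p' has_real_derivative p'' t) (at t within {0..})" if "t \<ge> 0" for t
      unfolding p'_def[abs_def] p''_def unfolding p_def w_def
      by (rule derivative_eq_intros oscillator_derivatives[OF g that] refl)+
        (simp add: power2_eq_square algebra_simps)
    then have p': "(p' has_vector_derivative p'' t) (at t within {0..})" if "t \<ge> 0" for t
      using that by (simp add: dv)
    have ode: "p'' t + 2 * a * p' t + (a\<^sup>2 + b\<^sup>2) * p t = g t" for t
      by (simp add: p''_def algebra_simps)
    have init: "p 0 = 0" "p' 0 = 0"
      by (simp_all add: p_def p'_def w_def oscillator_response_def oscillator_velocity_def)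
    show "laplace (oscillator_kernel a b (Suc n)) x \<in> square_domain D A"
      "(\<lambda>y. A (A y) - (2 * a) *\<^sub>R A y + (a\<^sup>2 + b\<^sup>2) *\<^sub>R y) (laplace (oscillator_kernel a b (Suc n)) x)
        = laplace (oscillator_kernel a b n) x"
      using quadratic_laplace[OF p p' dp dp' dp'' c(1) init(1) ode, of x] init by (simp_all add: p_def g_def)
  qed
qed

text \<open>
  The Laplace integral of the damped sine is a right inverse of \<open>\<Delta>\<close> by the preceding lemma, and a
  left inverse since it commutes with the generator. The recursion for the kernels then computes
  the powers of the inverse.
\<close>

lemma quadratic_resolvent:
  fixes a b :: real
  assumes a: "a > \<omega>"
  defines "\<Delta> \<equiv> \<lambda>y. A (A y) - (2 * a) *\<^sub>R A y + (a\<^sup>2 + b\<^sup>2) *\<^sub>R y"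
  shows "bij_betw \<Delta> (square_domain D A) UNIV"
    and "(inv_into (square_domain D A) \<Delta> ^^ Suc n) x = laplace (oscillator_kernel a b n) x"
proof -
  let ?L = "\<lambda>n. laplace (oscillator_kernel a b n)"
  let ?S = "square_domain D A"
  define c where "c = (a + \<omega>) / 2"
  have c: "c > \<omega>" "c < a" using a by (auto simp: c_def)
  note dec = exp_decaying_oscillator_kernel[OF c(2), of b 0]
  interpret L: bounded_linear "?L 0" by (rule bounded_linear_laplace[OF dec c(1)])
  have dom: "?L n x \<in> ?S" for n x
    using quadratic_laplace_oscillator(1,2)[OF a] by (cases n) auto
  have right: "\<Delta> (?L 0 x) = x" "\<Delta> (?L (Suc n) x) = ?L n x" for n x
    using quadratic_laplace_oscillator(3,4)[OF a] by (auto simp: \<Delta>_def)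
  have left: "?L 0 (\<Delta> x) = x" if "x \<in> ?S" for x
  proof -
    have x: "x \<in> D" "A x \<in> D" using that by (auto simp: square_domain_def)
    have "\<Delta> (?L 0 x) = ?L 0 (\<Delta> x)"
      unfolding \<Delta>_def using generator_laplace_commute[OF dec c(1)] x
      by (simp only: L.add L.diff L.scaleR)
    then show ?thesis using right by simp
  qed
  have inj: "inj_on \<Delta> ?S"
    by (rule inj_on_inverseI[of _ "?L 0"]) (rule left)
  moreover have "\<Delta> ` ?S = UNIV"
    using right(1) dom by (metis UNIV_eq_I image_eqI)
  ultimately show "bij_betw \<Delta> ?S UNIV"
    by (simp add: bij_betw_def)
  have inv: "inv_into ?S \<Delta> (\<Delta> y) = y" if "y \<in> ?S" for y
    using inj that by (rule inv_into_f_f)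
  show "(inv_into ?S \<Delta> ^^ Suc n) x = ?L n x"
  proof (induction n)
    case 0
    then show ?case using inv[OF dom[of 0 x]] right(1) by simp
  next
    case (Suc n)
    then show ?case using inv[OF dom[of "Suc n" x]] right(2)[of n x] by simp
  qed
qed

lemma norm_laplace_oscillator_kernel_le:
  assumes a: "a > \<omega>"
  shows "norm (laplace (oscillator_kernel a b n) x) \<le> M / (a - \<omega>) ^ (2 * Suc n) * norm x"
proof -
  define c where "c = (a + \<omega>) / 2"
  have c: "c > \<omega>" "c < a" using a by (auto simp: c_def)
  have "norm (laplace (oscillator_kernel a b n) x) \<le> M * (1 / (a - \<omega>) ^ Suc (2 * n + 1)) * norm x"
  proof (rule norm_laplace_le[OF exp_decaying_oscillator_kernel[OF c(2)] c(1)])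
    let ?g = "\<lambda>t. exp (- ((a - \<omega>) * t)) * (t ^ (2 * n + 1) / fact (2 * n + 1))"
    show "continuous_on {0..} ?g"
      by (intro continuous_intros) auto
    show "integral {0..N} ?g \<le> 1 / (a - \<omega>) ^ Suc (2 * n + 1)" if "N \<ge> 0" for N
      by (rule integral_exp_power_le) (use a that in auto)
    show "\<bar>oscillator_kernel a b n t\<bar> * exp (\<omega> * t) \<le> ?g t" if "t \<ge> 0" for t
    proof -
      have "\<bar>oscillator_kernel a b n t\<bar> * exp (\<omega> * t)
          \<le> (exp (- (a * t)) * (t ^ (2 * n + 1) / fact (2 * n + 1))) * exp (\<omega> * t)"
        by (intro mult_right_mono abs_oscillator_kernel_le that) simp
      also have "\<dots> = (exp (- (a * t)) * exp (\<omega> * t)) * (t ^ (2 * n + 1) / fact (2 * n + 1))"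
        by (simp only: mult_ac)
      also have "exp (- (a * t)) * exp (\<omega> * t) = exp (- ((a - \<omega>) * t))"
        by (simp add: exp_add[symmetric] algebra_simps)
      finally show ?thesis .
    qed
  qed
  then show ?thesis by simp
qed

end

section \<open>Slice exponentials\<close>

lemma power_imaginary_unit:
  fixes j :: "'a::real_algebra_1"
  assumes "j\<^sup>2 = - 1"
  shows "j ^ (2 * k) = (- 1) ^ k *\<^sub>R 1" and "j ^ Suc (2 * k) = (- 1) ^ k *\<^sub>R j"
proof -
  have m: "(- 1 :: 'a) ^ k = (- 1) ^ k *\<^sub>R 1"
    by (induction k) auto
  have e: "j ^ (2 * k) = (- 1) ^ k"
    by (simp add: power_mult assms)
  show "j ^ (2 * k) = (- 1) ^ k *\<^sub>R 1"
    by (simp only: e m)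
  then show "j ^ Suc (2 * k) = (- 1) ^ k *\<^sub>R j"
    by simp
qed

text \<open>
  Euler's formula in any slice, by comparing power series: the even powers of \<open>j\<close> are \<open>1\<close> and
  \<open>-1\<close>, the odd ones \<open>j\<close> and \<open>-j\<close>.
\<close>

lemma exp_imaginary_unit:
  fixes j :: "'a::{real_normed_algebra_1,banach}"
  assumes j: "j\<^sup>2 = - 1"
  shows "exp (s *\<^sub>R j) = of_real (cos s) + sin s *\<^sub>R j"
proof -
  have "(\<lambda>n. (cos_coeff n *\<^sub>R s ^ n) *\<^sub>R (1::'a) + (sin_coeff n *\<^sub>R s ^ n) *\<^sub>R j)
      sums (cos s *\<^sub>R 1 + sin s *\<^sub>R j)"
    by (intro sums_add sums_scaleR_left cos_converges sin_converges)
  moreover have "(\<lambda>n. (cos_coeff n *\<^sub>R s ^ n) *\<^sub>R (1::'a) + (sin_coeff n *\<^sub>R s ^ n) *\<^sub>R j)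
      = (\<lambda>n. (s *\<^sub>R j) ^ n /\<^sub>R fact n)"
  proof
    fix n
    show "(cos_coeff n *\<^sub>R s ^ n) *\<^sub>R (1::'a) + (sin_coeff n *\<^sub>R s ^ n) *\<^sub>R j = (s *\<^sub>R j) ^ n /\<^sub>R fact n"
    proof (cases "even n")
      case True
      then obtain k where "n = 2 * k" by (rule evenE)
      then show ?thesis
        using power_imaginary_unit(1)[OF j, of k]
        by (simp add: cos_coeff_def sin_coeff_def scaleR_power divide_inverse mult_ac)
    next
      case False
      then obtain k where "n = Suc (2 * k)" by (auto elim: oddE)
      then show ?thesis
        using power_imaginary_unit(2)[OF j, of k]
        by (simp add: cos_coeff_def sin_coeff_def scaleR_power divide_inverse mult_ac del: power_Suc)
    qed
  qed
  ultimately have "(\<lambda>n. (s *\<^sub>R j) ^ n /\<^sub>R fact n) sums (cos s *\<^sub>R 1 + sin s *\<^sub>R j)"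
    by simp
  from sums_unique2[OF exp_converges this] show ?thesis
    by (simp only: of_real_def)
qed

lemma exp_slice:
  fixes j :: "'a::{real_normed_algebra_1,banach}"
  assumes j: "j\<^sup>2 = - 1"
  shows "exp (t *\<^sub>R (of_real a + b *\<^sub>R j)) = exp (t * a) *\<^sub>R (of_real (cos (t * b)) + sin (t * b) *\<^sub>R j)"
proof -
  have "exp (t *\<^sub>R (of_real a + b *\<^sub>R j)) = exp (of_real (t * a) + (t * b) *\<^sub>R j)"
    by (simp add: of_real_def scaleR_add_right)
  also have "\<dots> = exp (of_real (t * a)) * exp ((t * b) *\<^sub>R j)"
    by (rule exp_add_commuting) (simp add: of_real_def)
  also have "\<dots> = of_real (exp (t * a)) * (of_real (cos (t * b)) + sin (t * b) *\<^sub>R j)"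
    by (simp only: exp_imaginary_unit[OF j] exp_of_real)
  finally show ?thesis by (simp only: scaleR_conv_of_real)
qed

lemma alg_inverse_eqI:
  assumes "p * y = 1" "y * p = 1"
  shows "alg_inverse p = y"
  unfolding alg_inverse_def
proof (rule the_equality)
  fix z assume "p * z = 1 \<and> z * p = 1"
  then show "z = y" using assms by (metis mult.assoc mult_1_left mult_1_right)
qed (use assms in simp)

locale slice_point = star_algebra cj
  for cj :: "'a::{real_normed_algebra_1,banach} \<Rightarrow> 'a" +
  fixes a b :: real and j q :: 'a
  assumes j: "j \<in> imag_units cj" and q: "q = of_real a + b *\<^sub>R j"
begin

lemma j_square: "j * j = - 1" and cj_j: "cj j = - j"
  using j by (auto simp: imag_units_def power2_eq_square)

lemma cj_q: "cj q = of_real a + (- b) *\<^sub>R j"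
  unfolding q using cj_linear by (simp add: linear_add linear_scale cj_of_real cj_j)

lemma re_part_q: "re_part cj q = a"
  unfolding re_part_def
proof (rule the_equality)
  have "(1/2) *\<^sub>R (q + cj q) = (1/2) *\<^sub>R (of_real a + of_real a)"
    unfolding cj_q by (simp add: q)
  also have "\<dots> = of_real a"
    by (simp add: scaleR_add_right flip: scaleR_add_left)
  finally show *: "of_real a = (1/2) *\<^sub>R (q + cj q)" ..
  fix r assume "of_real r = (1/2) *\<^sub>R (q + cj q)"
  then have "of_real r = (of_real a :: 'a)" by (simp only: *)
  then show "r = a" by simp
qed

lemma q_mult_cj_q: "q * cj q = of_real (a\<^sup>2 + b\<^sup>2)"
  unfolding cj_q unfolding q
  by (simp add: algebra_simps of_real_def j_square power2_eq_square)

lemma q_real_iff: "q \<in> \<real> \<longleftrightarrow> b = 0"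
proof
  assume "q \<in> \<real>"
  then obtain r where "q = of_real r" by (auto elim: Reals_cases)
  then have bj: "b *\<^sub>R j = of_real (r - a)"
    unfolding q by (metis add_diff_cancel_left' of_real_diff)
  have "of_real (- (b\<^sup>2)) = (b *\<^sub>R j) * (b *\<^sub>R j)"
    by (simp add: j_square power2_eq_square of_real_def)
  also have "\<dots> = of_real ((r - a)\<^sup>2)"
    by (simp only: bj power2_eq_square of_real_mult)
  finally have "- (b\<^sup>2) = (r - a)\<^sup>2" by (simp only: of_real_eq_iff)
  then have "b\<^sup>2 \<le> 0" using zero_le_power2[of "r - a"] by linarith
  then show "b = 0" by simp
qed (simp add: q)

text \<open>
  For \<open>b \<noteq> 0\<close> the factor \<open>j\<close> of the difference of exponentials cancels against the inverse of
  \<open>q - cj q = (2 * b) *\<^sub>R j\<close>, so the slice derivative of the exponential is a real number.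
\<close>

lemma exp_s'_eq: "exp_s' cj (- t) q = of_real (- damped_sine a b t)"
proof (cases "b = 0")
  case True
  then have "q = of_real a" by (simp add: q)
  moreover have "(- t) *\<^sub>R of_real a = (of_real (- (a * t)) :: 'a)"
    by (simp add: of_real_def)
  ultimately have "exp_s' cj (- t) q = (- t) *\<^sub>R of_real (exp (- (a * t)))"
    by (simp only: exp_s'_def Reals_of_real if_True exp_of_real)
  then show ?thesis
    using True by (simp add: damped_sine_def sine_quotient_def scaleR_conv_of_real mult.commute)
next
  case False
  have j2: "j\<^sup>2 = - 1" by (simp add: power2_eq_square j_square)
  have qc: "q - cj q = (2 * b) *\<^sub>R j"
    unfolding cj_q by (simp add: q scaleR_add_left[symmetric])
  have inv: "alg_inverse (q - cj q) = (- 1 / (2 * b)) *\<^sub>R j"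
    unfolding qc using False by (intro alg_inverse_eqI) (simp_all add: j_square)
  have diff: "u *\<^sub>R (w + s *\<^sub>R j) - u *\<^sub>R (w + (- s) *\<^sub>R j) = (u * (2 * s)) *\<^sub>R j" for u s w
  proof -
    have "s *\<^sub>R j + s *\<^sub>R j = (2 * s) *\<^sub>R j"
      by (simp only: mult_2 scaleR_add_left)
    then have "(w + s *\<^sub>R j) - (w + (- s) *\<^sub>R j) = (2 * s) *\<^sub>R j"
      by (simp only: add_diff_cancel_left scaleR_minus_left diff_minus_eq_add)
    then have "u *\<^sub>R ((w + s *\<^sub>R j) - (w + (- s) *\<^sub>R j)) = (u * (2 * s)) *\<^sub>R j"
      by (simp only: scaleR_scaleR)
    then show ?thesis by (simp only: scaleR_diff_right)
  qed
  have "exp ((- t) *\<^sub>R q) - exp ((- t) *\<^sub>R cj q) = (exp (- (a * t)) * (- 2 * sin (b * t))) *\<^sub>R j"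
  proof -
    have trig: "(- t) * a = - (a * t)" "cos ((- t) * b) = cos (b * t)" "cos ((- t) * (- b)) = cos (b * t)"
      "sin ((- t) * b) = - sin (b * t)" "sin ((- t) * (- b)) = - (- sin (b * t))"
      "2 * - sin (b * t) = - 2 * sin (b * t)"
      by (simp_all add: mult.commute)
    show ?thesis
      unfolding cj_q unfolding q exp_slice[OF j2]
      using diff[of "exp (- (a * t))" "of_real (cos (b * t))" "- sin (b * t)"] by (simp only: trig)
  qed
  then have "exp_s' cj (- t) q = ((- 1 / (2 * b)) *\<^sub>R j) * ((exp (- (a * t)) * (- 2 * sin (b * t))) *\<^sub>R j)"
    using False by (simp only: exp_s'_def q_real_iff inv if_False)
  also have "\<dots> = of_real (- damped_sine a b t)"
    using False by (simp add: j_square damped_sine_def sine_quotient_def of_real_def)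
  finally show ?thesis .
qed

text \<open>
  Each of the \<open>n + 1\<close> factors contributes the sign of the damped sine.
\<close>

lemma conv_power_exp_s':
  assumes "t \<ge> 0"
  shows "conv_power (\<lambda>\<tau>. exp_s' cj (- \<tau>) q) (Suc n) t = of_real ((- 1) ^ Suc n * oscillator_kernel a b n t)"
  using assms
proof (induction n arbitrary: t)
  case 0
  show ?case by (simp add: conv_power_def exp_s'_eq)
next
  case (Suc n)
  let ?p = "oscillator_kernel a b n"
  have cont: "continuous_on {0..t} (\<lambda>s. damped_sine a b (t - s) * ((- 1) ^ Suc (Suc n) * ?p s))"
    by (intro continuous_intros continuous_on_compose2[OF continuous_on_damped_sine[of UNIV]]
        continuous_on_subset[OF continuous_on_oscillator_kernel]) auto
  have "conv_power (\<lambda>\<tau>. exp_s' cj (- \<tau>) q) (Suc (Suc n)) t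
      = conv (\<lambda>\<tau>. exp_s' cj (- \<tau>) q) (conv_power (\<lambda>\<tau>. exp_s' cj (- \<tau>) q) (Suc n)) t"
    by (simp add: conv_power_def)
  also have "\<dots> = integral {0..t} (\<lambda>s. of_real (damped_sine a b (t - s) * ((- 1) ^ Suc (Suc n) * ?p s)))"
    unfolding conv_def
  proof (rule integral_cong)
    fix s assume "s \<in> {0..t}"
    then have IH: "conv_power (\<lambda>\<tau>. exp_s' cj (- \<tau>) q) (Suc n) s = of_real ((- 1) ^ Suc n * ?p s)"
      by (intro Suc.IH) simp
    show "exp_s' cj (- (t - s)) q * conv_power (\<lambda>\<tau>. exp_s' cj (- \<tau>) q) (Suc n) s
        = of_real (damped_sine a b (t - s) * ((- 1) ^ Suc (Suc n) * ?p s))"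
      unfolding IH unfolding exp_s'_eq of_real_mult[symmetric] by simp
  qed
  also have "\<dots> = of_real (integral {0..t} (\<lambda>s. damped_sine a b (t - s) * ((- 1) ^ Suc (Suc n) * ?p s)))"
    using integral_linear[OF integrable_continuous_real[OF cont] bounded_linear_of_real]
    by (simp only: o_def)
  also have "integral {0..t} (\<lambda>s. damped_sine a b (t - s) * ((- 1) ^ Suc (Suc n) * ?p s))
      = (- 1) ^ Suc (Suc n) * oscillator_kernel a b (Suc n) t"
    unfolding oscillator_kernel.simps oscillator_response_def
    by (simp only: mult.left_commute[of _ "(- 1) ^ Suc (Suc n)"] Henstock_Kurzweil_Integration.integral_mult_right)
  finally show ?case .
qed

end

section \<open>Semigroups on a Banach module\<close>

lemma bounded_right_linear_bounded_linear:
  assumes module: "banach_two_sided_module lm rm" and B: "B \<in> bounded_right_linear rm"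
  shows "bounded_linear B"
proof -
  interpret banach_two_sided_module lm rm by fact
  have add: "B (x + y) = B x + B y" and B_rm: "B (rm x p) = rm (B x) p" for x y p
    using B by (auto simp: bounded_right_linear_def right_linear_on_def)
  obtain K where K: "\<And>x. norm (B x) / norm x \<le> K"
    using B by (auto simp: bounded_right_linear_def bdd_above_def)
  have scale: "B (r *\<^sub>R x) = r *\<^sub>R B x" for r x
    using B_rm[of x "of_real r"] by (simp add: rm_of_real)
  have "norm (B x) \<le> norm x * K" for x
  proof (cases "x = 0")
    case True
    then show ?thesis using scale[of 0 0] by simp
  next
    case False
    then show ?thesis using K[of x] by (simp add: divide_le_eq mult.commute)
  qed
  with add scale show ?thesis by (rule bounded_linear_intro)
qed

lemma bounded_linear_right_mult:
  assumes "banach_two_sided_module lm rm"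
  shows "bounded_linear (\<lambda>x. rm x p)"
proof -
  interpret banach_two_sided_module lm rm by fact
  have "rm (r *\<^sub>R x) p = r *\<^sub>R rm x p" for r x
    by (metis lm_of_real lm_rm)
  then show ?thesis
    using norm_rm by (intro bounded_linear_intro[where K = "norm p"]) (auto simp: rm_add_left mult.commute)
qed

lemma bounded_right_linearI:
  assumes B: "bounded_linear B" and rm: "\<And>x p. B (rm x p) = rm (B x) p"
  shows "B \<in> bounded_right_linear rm"
proof -
  interpret bounded_linear B by fact
  have "norm (B x) / norm x \<le> onorm B" for x
    by (rule le_onorm[OF B])
  then show ?thesis
    using rm by (auto simp: bounded_right_linear_def right_linear_on_def right_submodule_def add bdd_above_def)
qed

text \<open>
  The operators \<open>T t\<close> are bounded linear over the reals because right multiplication by a real element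
  of the algebra is real scaling. This embeds the module semigroup into the theory above.
\<close>

lemma semigroup_generator_growth_bound:
  assumes module: "banach_two_sided_module lm rm"
    and semigroup: "strongly_continuous_semigroup rm T"
    and generator: "is_generator T D A"
    and bdd: "bdd_above ((\<lambda>t. onorm (T t) * exp (- (\<omega> * t))) ` {0..})"
    and M: "M = (SUP t\<in>{0..}. onorm (T t) * exp (- (\<omega> * t)))"
  shows "semigroup_generator T M \<omega> D A"
proof (intro semigroup_generator.intro exp_bounded_semigroup.intro semigroup_generator_axioms.intro)
  show bl: "bounded_linear (T t)" if "t \<ge> 0" for t
    using semigroup that
    by (intro bounded_right_linear_bounded_linear[OF module]) (auto simp: strongly_continuous_semigroup_def)
  show T0: "T 0 x = x" for x
    using semigroup by (simp add: strongly_continuous_semigroup_def)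
  show "T (s + t) x = T s (T t x)" if "s \<ge> 0" "t \<ge> 0" for s t x
  proof (cases "s = 0 \<or> t = 0")
    case False
    then show ?thesis
      using semigroup that by (auto simp: strongly_continuous_semigroup_def)
  qed (auto simp: T0)
  show "continuous_on {0..} (\<lambda>t. T t x)" for x
    using semigroup by (simp add: strongly_continuous_semigroup_def)
  have le_M: "onorm (T t) * exp (- (\<omega> * t)) \<le> M" if "t \<ge> 0" for t
    unfolding M using that by (intro cSUP_upper bdd) auto
  show "M \<ge> 0"
    using le_M[of 0] onorm_pos_le[OF bl[of 0]] by simp
  show "norm (T t x) \<le> M * exp (\<omega> * t) * norm x" if t: "t \<ge> 0" for t x
  proof -
    have "onorm (T t) = (onorm (T t) * exp (- (\<omega> * t))) * exp (\<omega> * t)"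
      by (simp add: mult.assoc exp_add[symmetric])
    also have "\<dots> \<le> M * exp (\<omega> * t)"
      by (intro mult_right_mono le_M t) simp
    finally have "onorm (T t) * norm x \<le> M * exp (\<omega> * t) * norm x"
      by (rule mult_right_mono) simp
    with onorm[OF bl[OF t], of x] show ?thesis by linarith
  qed
  show "is_generator T D A" by fact
qed

theorem corollary5p2:
  fixes cj :: "'a::{real_normed_algebra_1,banach} \<Rightarrow> 'a"
    and lm :: "'a \<Rightarrow> 'x::banach \<Rightarrow> 'x"
    and rm :: "'x \<Rightarrow> 'a \<Rightarrow> 'x"
    and T :: "real \<Rightarrow> 'x \<Rightarrow> 'x"
    and D :: "'x set"
    and A :: "'x \<Rightarrow> 'x"
    and \<omega> M :: real
  assumes star: "star_algebra cj"
    and fin_dim: "\<exists>B :: 'a set. finite B \<and> span B = UNIV"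
    and units: "imag_units cj \<noteq> {}"
    and norm_cone: "\<forall>q \<in> quadratic_cone cj. of_real ((norm q)\<^sup>2) = q * cj q"
    and module: "banach_two_sided_module lm rm"
    and semigroup: "strongly_continuous_semigroup rm T"
    and generator: "is_generator T D A"
    and bdd: "bdd_above ((\<lambda>t. onorm (T t) * exp (- (\<omega> * t))) ` {0..})"
    and M_eq: "M = (SUP t\<in>{0..}. onorm (T t) * exp (- (\<omega> * t)))"
  shows "\<forall>q \<in> quadratic_cone cj. re_part cj q > \<omega> \<longrightarrow>
      q \<in> spherical_resolvent_set cj rm D A
      \<and> (\<forall>n::nat. n \<ge> 1 \<longrightarrow>
          (\<forall>x. bochner_integrable (lebesgue_on {0..})
                 (\<lambda>t. T t (lm (conv_power (\<lambda>\<tau>. exp_s' cj (- \<tau>) q) n t) x))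
             \<and> (quasi_resolvent cj D A q ^^ n) x =
                 (- 1) ^ n *\<^sub>R bochner_integral (lebesgue_on {0..})
                   (\<lambda>t. T t (lm (conv_power (\<lambda>\<tau>. exp_s' cj (- \<tau>) q) n t) x)))
          \<and> onorm (quasi_resolvent cj D A q ^^ n) \<le> M / (re_part cj q - \<omega>) ^ (2 * n))"
proof (intro ballI impI)
  fix q assume q_cone: "q \<in> quadratic_cone cj" and re: "re_part cj q > \<omega>"
  from q_cone obtain a b j where j: "j \<in> imag_units cj" and q: "q = of_real a + b *\<^sub>R j"
    by (auto simp: quadratic_cone_def complex_slice_def)
  interpret slice_point cj a b j q
    using star j q by (simp add: slice_point_def slice_point_axioms_def)
  interpret banach_two_sided_module lm rm by (rule module)
  interpret semigroup_generator T M \<omega> D A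
    by (rule semigroup_generator_growth_bound[OF module semigroup generator bdd M_eq])
  have a: "a > \<omega>" using re by (simp add: re_part_q)
  have norm_q: "(norm q)\<^sup>2 = a\<^sup>2 + b\<^sup>2"
    using norm_cone q_cone q_mult_cj_q by (metis of_real_eq_iff)
  have Delta: "Delta cj A q = (\<lambda>y. A (A y) - (2 * a) *\<^sub>R A y + (a\<^sup>2 + b\<^sup>2) *\<^sub>R y)"
    by (simp add: fun_eq_iff Delta_def re_part_q norm_q)
  let ?p = "oscillator_kernel a b"
  have power: "quasi_resolvent cj D A q ^^ Suc n = laplace (?p n)" for n
    unfolding quasi_resolvent_def Delta using quadratic_resolvent(2)[OF a] by blast
  define c where "c = (a + \<omega>) / 2"
  have c: "c > \<omega>" "c < a" using a by (auto simp: c_def)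
  note dec = exp_decaying_oscillator_kernel[OF c(2)]
  have "laplace (?p 0) (rm x r) = rm (laplace (?p 0) x) r" for x r
    using semigroup
    by (intro laplace_commute[OF dec c(1) bounded_linear_right_mult[OF module]])
      (auto simp: strongly_continuous_semigroup_def bounded_right_linear_def right_linear_on_def)
  then have "quasi_resolvent cj D A q \<in> bounded_right_linear rm"
    using power[of 0] bounded_linear_laplace[OF dec c(1), of b 0] by (intro bounded_right_linearI) simp_all
  then have "q \<in> spherical_resolvent_set cj rm D A"
    using q_cone quadratic_resolvent(1)[OF a, of b] by (simp add: spherical_resolvent_set_def Delta)
  moreover have "bochner_integrable (lebesgue_on {0..})
                 (\<lambda>t. T t (lm (conv_power (\<lambda>\<tau>. exp_s' cj (- \<tau>) q) n t) x))
             \<and> (quasi_resolvent cj D A q ^^ n) x =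
                 (- 1) ^ n *\<^sub>R bochner_integral (lebesgue_on {0..})
                   (\<lambda>t. T t (lm (conv_power (\<lambda>\<tau>. exp_s' cj (- \<tau>) q) n t) x))"
    if "n \<ge> 1" for n x
  proof -
    obtain m where m: "n = Suc m" using \<open>n \<ge> 1\<close> by (cases n) auto
    let ?f = "\<lambda>t. T t (lm (conv_power (\<lambda>\<tau>. exp_s' cj (- \<tau>) q) n t) x)"
    let ?g = "\<lambda>t. ((- 1) ^ n * ?p m t) *\<^sub>R T t x"
    have fg: "?f t = ?g t" if "t \<ge> 0" for t
      using conv_power_exp_s'[OF that, of m] linear_simps(5)[OF bounded_linear_T[OF that]]
      by (simp only: m lm_of_real)
    have "exp_decaying (c - \<omega>) ?g"
      by (intro exp_decaying_orbit exp_decaying_scale dec)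
    then have "exp_decaying (c - \<omega>) ?f"
      using fg continuous_on_cong[of "{0..}" "{0..}" ?f ?g] by (simp add: exp_decaying_def)
    then have "has_bochner (lebesgue_on {0..}) ?f (half_line_integral ?f)"
      by (rule has_bochner_half_line_integral) (use c in simp)
    moreover have "half_line_integral ?f = (- 1) ^ n *\<^sub>R laplace (?p m) x"
      using half_line_integral_cong[of ?f ?g] fg laplace_scale_kernel[OF dec c(1), of "(- 1) ^ n" b m x]
      by (simp add: laplace_def)
    ultimately have hb: "has_bochner (lebesgue_on {0..}) ?f ((- 1) ^ n *\<^sub>R laplace (?p m) x)"
      by simp
    then have "(quasi_resolvent cj D A q ^^ n) x = (- 1) ^ n *\<^sub>R bochner_integral (lebesgue_on {0..}) ?f"
      by (simp add: bochner_integral_eqI m power power_mult_distrib[symmetric] del: funpow.simps)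
    with hb show ?thesis by (auto simp: bochner_integrable_def)
  qed
  moreover have "onorm (quasi_resolvent cj D A q ^^ n) \<le> M / (re_part cj q - \<omega>) ^ (2 * n)" if "n \<ge> 1" for n
  proof -
    obtain m where m: "n = Suc m" using \<open>n \<ge> 1\<close> by (cases n) auto
    show ?thesis
      unfolding m power re_part_q
      by (rule onorm_bound) (use norm_laplace_oscillator_kernel_le[OF a] a M_nonneg in auto)
  qed
  ultimately show "q \<in> spherical_resolvent_set cj rm D A
      \<and> (\<forall>n::nat. n \<ge> 1 \<longrightarrow>
          (\<forall>x. bochner_integrable (lebesgue_on {0..})
                 (\<lambda>t. T t (lm (conv_power (\<lambda>\<tau>. exp_s' cj (- \<tau>) q) n t) x))
             \<and> (quasi_resolvent cj D A q ^^ n) x =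
                 (- 1) ^ n *\<^sub>R bochner_integral (lebesgue_on {0..})
                   (\<lambda>t. T t (lm (conv_power (\<lambda>\<tau>. exp_s' cj (- \<tau>) q) n t) x)))
          \<and> onorm (quasi_resolvent cj D A q ^^ n) \<le> M / (re_part cj q - \<omega>) ^ (2 * n))"
    by blast
qed

end
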